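(* For all real numbers $0 \le \alpha \le \beta \le 1$, there exists a singular spectral measure $\mu$ on $\mathbb{R}$ without compact support such that $$\dim_H \mathrm{spt}(\mu) = \alpha \le \beta = \dim_P \mathrm{spt}(\mu).$$
   Context: A Borel probability measure $\mu$ on $\mathbb{R}$ is a spectral measure if there exists a countable set $\Lambda \subseteq \mathbb{R}$ such that the family of functions $\{x \mapsto e^{-2\pi i \lambda x} : \lambda \in \Lambda\}$ forms an orthonormal basis of $L^2(\mu)$. Singular means mutually singular with respect to Lebesgue measure on $\mathbb{R}$. The support $\mathrm{spt}(\mu)$ is the smallest closed set of full measure, i.e. $\mathrm{spt}(\mu) = \mathbb{R} \setminus \bigcup\{U \subseteq \mathbb{R} : U \text{ open}, \mu(U)=0\}$; "without compact support" means that $\mathrm{spt}(\mu)$ is not compact. $\dim_H$ and $\dim_P$ denote Hausdorff dimension and packing dimension, respectively. *)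

theory Defs
  imports "HOL-Probability.Probability"
begin

section \<open>Spectral measures\<close>

text \<open>
  Elements of \<open>L\<^sup>2(M)\<close> are represented by functions, not by classes modulo
  almost-everywhere equality; all notions below are invariant under that equality.
\<close>

definition L2_space :: "'a measure \<Rightarrow> ('a \<Rightarrow> complex) set" where
  "L2_space M = {f \<in> borel_measurable M. integrable M (\<lambda>x. (cmod (f x))\<^sup>2)}"

definition L2_inner :: "'a measure \<Rightarrow> ('a \<Rightarrow> complex) \<Rightarrow> ('a \<Rightarrow> complex) \<Rightarrow> complex" where
  "L2_inner M f g = (LINT x|M. f x * cnj (g x))"

definition L2_norm :: "'a measure \<Rightarrow> ('a \<Rightarrow> complex) \<Rightarrow> real" where
  "L2_norm M f = sqrt (LINT x|M. (cmod (f x))\<^sup>2)"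

text \<open>Orthonormal family whose linear span is dense in \<open>L\<^sup>2(M)\<close>.\<close>

definition L2_orthonormal_basis :: "'a measure \<Rightarrow> ('i \<Rightarrow> 'a \<Rightarrow> complex) \<Rightarrow> 'i set \<Rightarrow> bool" where
  "L2_orthonormal_basis M e I \<longleftrightarrow>
     (\<forall>i\<in>I. e i \<in> L2_space M) \<and>
     (\<forall>i\<in>I. \<forall>j\<in>I. L2_inner M (e i) (e j) = (if i = j then 1 else 0)) \<and>
     (\<forall>f\<in>L2_space M. \<forall>\<epsilon>>0. \<exists>F c. finite F \<and> F \<subseteq> I \<and>
        L2_norm M (\<lambda>x. f x - (\<Sum>i\<in>F. c i * e i x)) < \<epsilon>)"

definition spectral_measure :: "real measure \<Rightarrow> bool" where
  "spectral_measure M \<longleftrightarrow> real_distribution M \<and>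
     (\<exists>\<Lambda> :: real set. countable \<Lambda> \<and>
        L2_orthonormal_basis M
          (\<lambda>l x. exp (- 2 * of_real pi * \<i> * of_real l * of_real x)) \<Lambda>)"


section \<open>Singularity and support\<close>

definition mutually_singular :: "'a measure \<Rightarrow> 'a measure \<Rightarrow> bool" where
  "mutually_singular M N \<longleftrightarrow> sets M = sets N \<and>
     (\<exists>A\<in>sets M. emeasure M A = 0 \<and> emeasure N (space N - A) = 0)"

definition spt :: "'a::topological_space measure \<Rightarrow> 'a set" where
  "spt M = UNIV - \<Union>{U. open U \<and> emeasure M U = 0}"


section \<open>Hausdorff dimension\<close>

text \<open>
  \<open>|U|\<^sup>s\<close> with the conventions that the empty set contributes \<open>0\<close> and that
  \<open>0\<^sup>0 = 1\<close> for nonempty sets (whereas \<open>0 powr 0 = 0\<close> in the library).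
\<close>

definition diam_pow :: "real \<Rightarrow> 'a::metric_space set \<Rightarrow> ennreal" where
  "diam_pow s U = (if U = {} then 0 else if s = 0 then 1 else ennreal (diameter U powr s))"

text \<open>
  Boundedness of the covering sets has to be required because \<^const>\<open>diameter\<close> is a real
  number, hence meaningless for unbounded sets.
\<close>

definition hausdorff_pre :: "real \<Rightarrow> real \<Rightarrow> 'a::metric_space set \<Rightarrow> ennreal" where
  "hausdorff_pre s \<delta> E =
     (INF U \<in> {U :: nat \<Rightarrow> 'a set. E \<subseteq> (\<Union>i. U i) \<and> (\<forall>i. bounded (U i) \<and> diameter (U i) \<le> \<delta>)}.
        \<Sum>i. diam_pow s (U i))"

definition hausdorff_measure :: "real \<Rightarrow> 'a::metric_space set \<Rightarrow> ennreal" where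
  "hausdorff_measure s E = (SUP \<delta> \<in> {0<..}. hausdorff_pre s \<delta> E)"

definition hausdorff_dim :: "'a::metric_space set \<Rightarrow> ereal" where
  "hausdorff_dim E = (INF s \<in> {s. 0 \<le> s \<and> hausdorff_measure s E = 0}. ereal s)"


section \<open>Packing dimension\<close>

text \<open>
  A \<open>\<delta>\<close>-packing of \<open>E\<close>: countably many disjoint closed balls with centres in \<open>E\<close> and radii
  in \<open>(0,\<delta>]\<close>, encoded as a set of pairs (centre, radius).
\<close>

definition packings :: "real \<Rightarrow> 'a::euclidean_space set \<Rightarrow> ('a \<times> real) set set" where
  "packings \<delta> E =
     {P. countable P \<and> (\<forall>(x, r) \<in> P. x \<in> E \<and> 0 < r \<and> r \<le> \<delta>) \<and>
         disjoint_family_on (\<lambda>(x, r). cball x r) P}"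

text \<open>The factor \<open>2 * r\<close> is the diameter of a ball of radius \<open>r\<close>.\<close>

definition packing_pre :: "real \<Rightarrow> real \<Rightarrow> 'a::euclidean_space set \<Rightarrow> ennreal" where
  "packing_pre s \<delta> E =
     (SUP P \<in> packings \<delta> E. \<Sum>\<^sub>\<infinity>(x, r)\<in>P. ennreal ((2 * r) powr s))"

definition packing_premeasure :: "real \<Rightarrow> 'a::euclidean_space set \<Rightarrow> ennreal" where
  "packing_premeasure s E = (INF \<delta> \<in> {0<..}. packing_pre s \<delta> E)"

text \<open>
  \<^const>\<open>packing_premeasure\<close> is not countably subadditive, which is why the packing measure
  takes an infimum over countable covers.
\<close>

definition packing_measure :: "real \<Rightarrow> 'a::euclidean_space set \<Rightarrow> ennreal" where
  "packing_measure s E =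
     (INF A \<in> {A :: nat \<Rightarrow> 'a set. E \<subseteq> (\<Union>i. A i)}. \<Sum>i. packing_premeasure s (A i))"

definition packing_dim :: "'a::euclidean_space set \<Rightarrow> ereal" where
  "packing_dim E = (INF s \<in> {s. 0 \<le> s \<and> packing_measure s E = 0}. ereal s)"

end

theory Submission
  imports Defs "HOL-Real_Asymp.Real_Asymp"
begin

text \<open>
  Let \<open>X\<close> be a random binary expansion in which only the digits at the positions \<open>b 0 < b 1 < \<dots>\<close>
  are random (fair coins) and all others vanish. The law of \<open>X\<close> gives mass
  \<open>2\<^bsup>- c n\<^esup>\<close> to each dyadic cell of length \<open>(1/2)\<^sup>n\<close> that it
  charges, where \<open>c n\<close> counts the positions up to \<open>n\<close>; hence the Hausdorff and
  packing dimensions of the support are the lower and upper densities of the set of positions. The finite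
  sums of distinct integers \<open>2\<^bsup>b k - 1\<^esup>\<close> are the
  frequencies of an orthonormal family of exponentials, which is complete as soon as the gaps between positions are unbounded. Since the frequencies
  are integers, \<open>X\<close> may be replaced by \<open>X + N\<close> for any integer-valued function
  \<open>N\<close> of the coins without affecting spectrality; an unbounded \<open>N\<close> destroys
  compactness of the support and leaves dimensions and singularity unchanged.
\<close>

section \<open>Hausdorff and packing dimension\<close>

text \<open>The finite heart is a duality: for sets \<open>F\<close>, \<open>H\<close> of indices
  below \<open>n\<close>, the matrix \<open>chr (freq F * pos H)\<close> of size
  \<open>2 ^ n\<close> has orthogonal rows and columns, because the weight of \<open>k\<close> in
  \<open>freq\<close> times the weight of \<open>j\<close> in \<open>pos\<close> is 1/2 for
  \<open>k = j\<close> and an integer for \<open>j < k\<close>. Orthogonality passes to infinite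
  expansions exactly. Completeness does not: a tail times a large frequency is small only behind a
  gap. Such gaps are needed merely infinitely often, so they can have density zero, which admits
  even \<alpha> = 1. They pay a second time there: dimension 1 says nothing about singularity, but
  the gaps leave the support Lebesgue null. All this is done on coin sequences rather than on the
  line, so that the shift enters only through the final image measure. The shift is twice the index
  of the first \<open>True\<close> coin: every index has positive probability, and the factor 2
  keeps the translates of [0, 1] at distance at least 1, so that a small ball sees a single
  translate.\<close>

lemma hausdorff_pre_mono: "E \<subseteq> F \<Longrightarrow> hausdorff_pre s \<delta> E \<le> hausdorff_pre s \<delta> F"
  unfolding hausdorff_pre_def by (intro INF_superset_mono) auto

text \<open>Covers of cost below \<open>e / 2 ^ (k + 1)\<close> are merged through the pairing
  function. The mesh \<open>\<delta>\<close> stays fixed, so infinitely many translates can be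
  treated at once.\<close>

lemma hausdorff_pre_Union_eq_0:
  fixes E :: "nat \<Rightarrow> 'a::metric_space set"
  assumes zero: "\<And>k. hausdorff_pre s \<delta> (E k) = 0"
  shows "hausdorff_pre s \<delta> (\<Union>k. E k) = 0"
proof -
  have "hausdorff_pre s \<delta> (\<Union>k. E k) \<le> 0 + ennreal e" if "e > 0" for e :: real
  proof -
    have "\<exists>U. E k \<subseteq> (\<Union>i. U i) \<and> (\<forall>i. bounded (U i) \<and> diameter (U i) \<le> \<delta>) \<and>
            (\<Sum>i. diam_pow s (U i)) < ennreal (e * (1/2) ^ Suc k)" for k
    proof -
      have "hausdorff_pre s \<delta> (E k) < ennreal (e * (1/2) ^ Suc k)"
        using zero[of k] \<open>e > 0\<close> by (simp add: ennreal_zero_less_divide)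
      then show ?thesis unfolding hausdorff_pre_def INF_less_iff by blast
    qed
    then obtain U where U: "\<And>k. E k \<subseteq> (\<Union>i. U k i)"
      "\<And>k i. bounded (U k i)" "\<And>k i. diameter (U k i) \<le> \<delta>"
      "\<And>k. (\<Sum>i. diam_pow s (U k i)) < ennreal (e * (1/2) ^ Suc k)"
      by metis
    define V where "V i = case_prod U (prod_decode i)" for i
    have "(\<Union>k. E k) \<subseteq> (\<Union>i. V i)"
    proof
      fix x assume "x \<in> (\<Union>k. E k)"
      then obtain k i where "x \<in> U k i" using U(1) by blast
      then have "x \<in> V (prod_encode (k, i))" by (simp add: V_def)
      then show "x \<in> (\<Union>i. V i)" by blast
    qed
    moreover have "\<forall>i. bounded (V i) \<and> diameter (V i) \<le> \<delta>"
      using U(2,3) by (simp add: V_def split: prod.split)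
    ultimately have "hausdorff_pre s \<delta> (\<Union>k. E k) \<le> (\<Sum>i. diam_pow s (V i))"
      unfolding hausdorff_pre_def by (intro INF_lower) auto
    also have "\<dots> = (\<Sum>i. (\<lambda>p. diam_pow s (case_prod U p)) (prod_decode i))"
      by (simp add: V_def)
    also have "\<dots> = (\<Sum>k. \<Sum>i. diam_pow s (U k i))"
      by (rule suminf_ennreal_2dimen) simp
    also have "\<dots> \<le> (\<Sum>k. ennreal (e * (1/2) ^ Suc k))"
      using U(4) by (intro suminf_le less_imp_le summableI) auto
    also have "\<dots> = ennreal e"
      using sums_mult[OF power_half_series, of e] \<open>e > 0\<close>
      by (intro suminf_ennreal_eq) (auto simp del: power_Suc)
    finally show ?thesis by simp
  qed
  then show ?thesis
    by (metis ennreal_le_epsilon le_zero_eq)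
qed

lemma hausdorff_pre_le_finite_cover:
  assumes "finite I" "E \<subseteq> (\<Union>i\<in>I. U i)" "\<And>i. i \<in> I \<Longrightarrow> bounded (U i) \<and> diameter (U i) \<le> \<delta>" "0 \<le> \<delta>"
  shows "hausdorff_pre s \<delta> E \<le> (\<Sum>i\<in>I. diam_pow s (U i))"
proof -
  obtain h where h: "bij_betw h {0..<card I} I"
    using ex_bij_betw_nat_finite[OF assms(1)] by blast
  \<comment> \<open>Padding by the empty set, whose \<open>diam_pow\<close> is 0 even for
    \<open>s = 0\<close>.\<close>
  define V where "V n = (if n < card I then U (h n) else {})" for n
  have hI: "h n \<in> I" if "n < card I" for n using h that by (auto simp: bij_betw_def)
  have "E \<subseteq> (\<Union>n. V n)"
  proof
    fix x assume "x \<in> E"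
    then obtain i where "i \<in> I" "x \<in> U i" using assms(2) by blast
    moreover have "h ` {0..<card I} = I" using h by (simp add: bij_betw_def)
    ultimately obtain n where "n < card I" "h n = i" by (metis atLeastLessThan_iff imageE)
    then show "x \<in> (\<Union>n. V n)" using \<open>x \<in> U i\<close> by (auto simp: V_def intro!: exI[of _ n])
  qed
  moreover have "\<forall>n. bounded (V n) \<and> diameter (V n) \<le> \<delta>"
    using assms(3,4) hI by (simp add: V_def)
  ultimately have "hausdorff_pre s \<delta> E \<le> (\<Sum>n. diam_pow s (V n))"
    unfolding hausdorff_pre_def by (intro INF_lower) auto
  also have "\<dots> = (\<Sum>n\<in>{0..<card I}. diam_pow s (V n))"
    by (intro suminf_finite) (auto simp: V_def diam_pow_def)
  also have "\<dots> = (\<Sum>n\<in>{0..<card I}. diam_pow s (U (h n)))"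
    by (intro sum.cong) (auto simp: V_def)
  also have "\<dots> = (\<Sum>i\<in>I. diam_pow s (U i))"
    by (rule sum.reindex_bij_betw[OF h])
  finally show ?thesis .
qed

section \<open>Bounds on dimensions by comparison with the mass of balls\<close>

lemma hausdorff_dim_le:
  assumes "0 \<le> \<alpha>" "\<And>s. s > \<alpha> \<Longrightarrow> hausdorff_measure s E = 0"
  shows "hausdorff_dim E \<le> ereal \<alpha>"
proof (rule ereal_le_epsilon2)
  fix e :: real assume "0 < e"
  then have "hausdorff_dim E \<le> ereal (\<alpha> + e)"
    unfolding hausdorff_dim_def using assms by (intro INF_lower) auto
  then show "hausdorff_dim E \<le> ereal \<alpha> + ereal e" by simp
qed

lemma packing_dim_le:
  assumes "0 \<le> \<beta>" "\<And>s. s > \<beta> \<Longrightarrow> packing_measure s E = 0"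
  shows "packing_dim E \<le> ereal \<beta>"
proof (rule ereal_le_epsilon2)
  fix e :: real assume "0 < e"
  then have "packing_dim E \<le> ereal (\<beta> + e)"
    unfolding packing_dim_def using assms by (intro INF_lower) auto
  then show "packing_dim E \<le> ereal \<beta> + ereal e" by simp
qed

lemma hausdorff_dim_ge:
  assumes "\<And>s. 0 \<le> s \<Longrightarrow> s < \<alpha> \<Longrightarrow> hausdorff_measure s E \<noteq> 0"
  shows "ereal \<alpha> \<le> hausdorff_dim E"
  unfolding hausdorff_dim_def using assms by (intro INF_greatest) (force simp: not_less[symmetric])

lemma packing_dim_ge:
  assumes "\<And>s. 0 \<le> s \<Longrightarrow> s < \<beta> \<Longrightarrow> packing_measure s E \<noteq> 0"
  shows "ereal \<beta> \<le> packing_dim E"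
  unfolding packing_dim_def using assms by (intro INF_greatest) (force simp: not_less[symmetric])

text \<open>A nonempty bounded set lies in the closed ball around any of its points with its
  diameter as radius, so \<open>C\<close> times the cost of a cover of mesh \<open>\<delta>\<close>
  is at least the mass of \<open>E\<close>.\<close>

lemma mass_distribution_principle:
  fixes E :: "'a::metric_space set"
  assumes M: "sets M = sets borel" and "emeasure M E > 0"
    and "0 \<le> s" "0 \<le> C" "0 < \<delta>"
    and ball: "\<And>x r. 0 < r \<Longrightarrow> r \<le> \<delta> \<Longrightarrow> emeasure M (cball x r) \<le> ennreal (C * r powr s)"
  shows "hausdorff_measure s E \<noteq> 0"
proof
  have [measurable]: "cball x r \<in> sets M" for x r using M by simp
  \<comment> \<open>Sets of diameter 0 would need a ball of radius 0, for which \<open>ball\<close>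
    says nothing; the point mass is bounded by letting the radius tend to 0.\<close>
  have point: "emeasure M {x} = 0" if "s > 0" for x
  proof -
    have "((\<lambda>r. C * r powr s) \<longlongrightarrow> C * 0 powr s) (at_right 0)"
      using \<open>s > 0\<close> by (intro tendsto_intros tendsto_powr') (auto intro: eventually_mono[OF eventually_at_right_less])
    then have "((\<lambda>r. ennreal (C * r powr s)) \<longlongrightarrow> ennreal 0) (at_right 0)"
      using \<open>s > 0\<close> by (intro tendsto_ennrealI) auto
    moreover have "\<forall>\<^sub>F r in at_right 0. emeasure M {x} \<le> ennreal (C * r powr s)"
    proof (rule eventually_mono)
      show "\<forall>\<^sub>F r in at_right 0. r \<in> {0<..<\<delta>}"
        using \<open>0 < \<delta>\<close> by (rule eventually_at_right_real)
      fix r assume "r \<in> {0<..<\<delta>}"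
      then show "emeasure M {x} \<le> ennreal (C * r powr s)"
        using ball[of r x] emeasure_mono[of "{x}" "cball x r" M]
        by (auto intro: order_trans)
    qed
    ultimately have "emeasure M {x} \<le> ennreal 0"
      by (rule tendsto_lowerbound) simp
    then show ?thesis by simp
  qed
  have hull: "\<exists>V\<in>sets M. U \<subseteq> V \<and> emeasure M V \<le> ennreal C * diam_pow s U"
    if U: "bounded U" "diameter U \<le> \<delta>" for U :: "'a set"
  proof (cases "U = {}")
    case False
    then obtain x where x: "x \<in> U" by blast
    have sub: "U \<subseteq> cball x (diameter U)"
      using diameter_bounded_bound[OF U(1) x] by auto
    show ?thesis
    proof (cases "diameter U = 0")
      case True
      show ?thesis
      proof (cases "s = 0")
        case s0: True
        \<comment> \<open>For \<open>s = 0\<close> points may carry mass, but then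
          \<open>diam_pow\<close> is 1 and a ball of any admissible radius does.\<close>
        have "U \<subseteq> cball x \<delta>" using sub True \<open>0 < \<delta>\<close> by auto
        then show ?thesis using ball[of \<delta> x] \<open>0 < \<delta>\<close> False s0
          by (intro bexI[of _ "cball x \<delta>"]) (auto simp: diam_pow_def)
      next
        case False
        have "{x} \<in> sets M" using M by simp
        then show ?thesis using point[of x] False \<open>0 \<le> s\<close> sub True by (intro bexI[of _ "{x}"]) auto
      qed
    next
      case d: False
      then have "diameter U > 0" using diameter_ge_0[OF U(1)] by simp
      then show ?thesis using ball[of "diameter U" x] U(2) sub False \<open>0 \<le> C\<close>
        by (intro bexI[of _ "cball x (diameter U)"]) (auto simp: diam_pow_def ennreal_mult)
    qed
  qed (auto intro!: bexI[of _ "{}"])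
  assume "hausdorff_measure s E = 0"
  then have pre0: "hausdorff_pre s \<delta> E = 0"
    using \<open>0 < \<delta>\<close> unfolding hausdorff_measure_def
    by (metis SUP_upper greaterThan_iff le_zero_eq)
  have le: "emeasure M E \<le> ennreal C * (\<Sum>i. diam_pow s (U i))"
    if U: "E \<subseteq> (\<Union>i. U i)" "\<And>i. bounded (U i)" "\<And>i. diameter (U i) \<le> \<delta>" for U :: "nat \<Rightarrow> 'a set"
  proof -
    obtain V where V: "\<And>i. V i \<in> sets M" "\<And>i. U i \<subseteq> V i"
      "\<And>i. emeasure M (V i) \<le> ennreal C * diam_pow s (U i)"
      using hull[OF U(2,3)] by metis
    have "emeasure M E \<le> emeasure M (\<Union>i. V i)"
      using U(1) V(1,2) by (intro emeasure_mono sets.countable_UN) blast+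
    also have "\<dots> \<le> (\<Sum>i. emeasure M (V i))"
      using V(1) by (intro emeasure_subadditive_countably) auto
    also have "\<dots> \<le> (\<Sum>i. ennreal C * diam_pow s (U i))"
      using V(3) by (intro suminf_le summableI) auto
    finally show ?thesis by simp
  qed
  \<comment> \<open>\<open>C + 1\<close> instead of \<open>C\<close> keeps the divisor positive when
    \<open>C = 0\<close>.\<close>
  have "emeasure M E / ennreal (C + 1) \<le> hausdorff_pre s \<delta> E"
    unfolding hausdorff_pre_def
  proof (rule INF_greatest, clarify)
    fix U :: "nat \<Rightarrow> 'a set"
    assume "E \<subseteq> \<Union> (range U)" "\<forall>i. bounded (U i) \<and> diameter (U i) \<le> \<delta>"
    then have "emeasure M E \<le> ennreal C * (\<Sum>i. diam_pow s (U i))" by (intro le) auto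
    also have "\<dots> \<le> ennreal (C + 1) * (\<Sum>i. diam_pow s (U i))"
      by (intro mult_right_mono ennreal_leI) auto
    finally show "emeasure M E / ennreal (C + 1) \<le> (\<Sum>i. diam_pow s (U i))"
      using \<open>0 \<le> C\<close> by (intro divide_le_posI_ennreal) (simp_all add: mult.commute del: ennreal_plus)
  qed
  with pre0 have "emeasure M E / ennreal (C + 1) = 0" by simp
  with \<open>emeasure M E > 0\<close> show False by (auto simp: ennreal_divide_eq_0_iff)
qed

text \<open>Each ball of a \<open>\<delta>\<close>-packing contributes at most a constant times
  \<open>\<delta> powr (s - t)\<close> times its mass, and disjoint balls share the total mass; the
  resulting bound vanishes as \<open>\<delta>\<close> tends to 0.\<close>

lemma packing_premeasure_eq_0:
  fixes A :: "'a::euclidean_space set"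
  assumes M: "finite_measure M" "sets M = sets borel" and "t < s" "0 < c" "0 < \<delta>\<^sub>0"
    and ball: "\<And>x r. x \<in> A \<Longrightarrow> 0 < r \<Longrightarrow> r \<le> \<delta>\<^sub>0 \<Longrightarrow> c * r powr t \<le> measure M (cball x r)"
  shows "packing_premeasure s A = 0"
proof -
  interpret finite_measure M by fact
  define C where "C = 2 powr s / c * measure M (space M)"
  have "0 \<le> C" using \<open>0 < c\<close> by (simp add: C_def)
  have pre: "packing_pre s \<delta> A \<le> ennreal (C * \<delta> powr (s - t))" if "0 < \<delta>" "\<delta> \<le> \<delta>\<^sub>0" for \<delta>
    unfolding packing_pre_def
  proof (rule SUP_least, rule infsum_le_finite_sums)
    fix P :: "('a \<times> real) set" and F
    assume P: "P \<in> packings \<delta> A" and F: "finite F" "F \<subseteq> P"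
    have F': "x \<in> A" "0 < r" "r \<le> \<delta>" if "(x, r) \<in> F" for x r
      using P F(2) that by (auto simp: packings_def)
    have "(2 * r) powr s \<le> 2 powr s / c * \<delta> powr (s - t) * measure M (cball x r)" if "(x, r) \<in> F" for x r
    proof -
      have "(2 * r) powr s = 2 powr s * (r powr (s - t) * r powr t)"
        using F'[OF that] by (simp add: powr_mult powr_add[symmetric])
      also have "\<dots> \<le> 2 powr s * (\<delta> powr (s - t) * (measure M (cball x r) / c))"
        using F'[OF that] ball[of x r] \<open>t < s\<close> \<open>0 < c\<close> \<open>\<delta> \<le> \<delta>\<^sub>0\<close>
        by (intro mult_left_mono mult_mono powr_mono2) (auto simp: field_simps)
      finally show ?thesis by (simp add: field_simps)
    qed
    then have "(\<Sum>(x, r)\<in>F. (2 * r) powr s)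
        \<le> (\<Sum>(x, r)\<in>F. 2 powr s / c * \<delta> powr (s - t) * measure M (cball x r))"
      by (intro sum_mono) (auto simp: case_prod_unfold)
    also have "\<dots> = 2 powr s / c * \<delta> powr (s - t) * (\<Sum>(x, r)\<in>F. measure M (cball x r))"
      by (simp add: sum_distrib_left case_prod_unfold)
    also have "(\<Sum>(x, r)\<in>F. measure M (cball x r)) = measure M (\<Union>(x, r)\<in>F. cball x r)"
    proof -
      have disj: "disjoint_family_on (\<lambda>(x, r). cball x r) F"
        using P unfolding packings_def by (elim CollectE conjE) (rule disjoint_family_on_mono[OF F(2)])
      have "measure M (\<Union>p\<in>F. (\<lambda>(x, r). cball x r) p) = (\<Sum>p\<in>F. measure M ((\<lambda>(x, r). cball x r) p))"
        by (rule finite_measure_finite_Union[OF F(1) _ disj]) (simp_all add: M(2) image_subset_iff case_prod_unfold)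
      then show ?thesis by (simp add: case_prod_unfold)
    qed
    also have "2 powr s / c * \<delta> powr (s - t) * measure M (\<Union>(x, r)\<in>F. cball x r) \<le>
               2 powr s / c * \<delta> powr (s - t) * measure M (space M)"
      using \<open>0 < c\<close> by (intro mult_left_mono bounded_measure) auto
    finally have "(\<Sum>(x, r)\<in>F. (2 * r) powr s) \<le> C * \<delta> powr (s - t)"
      by (simp add: C_def mult_ac)
    then show "(\<Sum>(x, r)\<in>F. ennreal ((2 * r) powr s)) \<le> ennreal (C * \<delta> powr (s - t))"
      by (simp add: case_prod_unfold sum_ennreal ennreal_leI)
  qed (simp add: nonneg_summable_on_complete)
  have "((\<lambda>\<delta>. C * \<delta> powr (s - t)) \<longlongrightarrow> C * 0 powr (s - t)) (at_right 0)"
    using \<open>t < s\<close> by (intro tendsto_intros tendsto_powr') (auto intro: eventually_mono[OF eventually_at_right_less])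
  then have "((\<lambda>\<delta>. ennreal (C * \<delta> powr (s - t))) \<longlongrightarrow> ennreal 0) (at_right 0)"
    using \<open>t < s\<close> by (intro tendsto_ennrealI) auto
  moreover have "\<forall>\<^sub>F \<delta> in at_right 0. packing_premeasure s A \<le> ennreal (C * \<delta> powr (s - t))"
  proof (rule eventually_mono)
    show "\<forall>\<^sub>F \<delta> in at_right 0. \<delta> \<in> {0<..<\<delta>\<^sub>0}"
      using \<open>0 < \<delta>\<^sub>0\<close> by (rule eventually_at_right_real)
    fix \<delta> assume "\<delta> \<in> {0<..<\<delta>\<^sub>0}"
    then show "packing_premeasure s A \<le> ennreal (C * \<delta> powr (s - t))"
      unfolding packing_premeasure_def
      by (intro INF_lower2[of \<delta>] pre) auto
  qed
  ultimately have "packing_premeasure s A \<le> ennreal 0"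
    by (rule tendsto_lowerbound) simp
  then show ?thesis by simp
qed

text \<open>One good radius below each \<open>\<delta>\<close> suffices, because a packing may be
  chosen with all radii equal: Vitali selects disjoint balls of radius \<open>r\<close> whose
  fivefold enlargements cover.\<close>

lemma packing_measure_nonzero:
  fixes E :: "'a::euclidean_space set"
  assumes M: "sets M = sets borel" and E: "E \<in> sets M" "emeasure M E > 0" and "0 < C"
    and scales: "\<And>\<delta>. 0 < \<delta> \<Longrightarrow> \<exists>r. 0 < r \<and> r \<le> \<delta> \<and> (\<forall>x. emeasure M (cball x (5 * r)) \<le> ennreal (C * r powr s))"
  shows "packing_measure s E \<noteq> 0"
proof -
  have [measurable]: "cball x r \<in> sets M" for x r using M by simp
  have sp: "space M = UNIV" using sets_eq_imp_space_eq[OF M] by simp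
  \<comment> \<open>Packings are weighed by the diameter \<open>2 * r\<close>, whence the factor
    \<open>2 powr s\<close>.\<close>
  define C' where "C' = C / 2 powr s"
  have "0 < C'" using \<open>0 < C\<close> by (simp add: C'_def)
  \<comment> \<open>The members of a countable cover of \<open>E\<close> are arbitrary sets, hence
    the outer measure.\<close>
  have pre: "outer_measure_of M A \<le> ennreal C' * packing_pre s \<delta> A" if "0 < \<delta>" for A \<delta>
  proof -
    obtain r where r: "0 < r" "r \<le> \<delta>" "\<And>x. emeasure M (cball x (5 * r)) \<le> ennreal (C * r powr s)"
      using scales[OF \<open>0 < \<delta>\<close>] by blast
    have "A \<subseteq> (\<Union>i\<in>A. cball (id i) r)" using r(1) by auto
    from Vitali_covering_lemma_cballs[OF this, of r] r(1)
    obtain D where D: "countable D" "D \<subseteq> A"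
      "pairwise (\<lambda>i j. disjnt (cball (id i) r) (cball (id j) r)) D" "A \<subseteq> (\<Union>i\<in>D. cball (id i) (5 * r))"
      by auto
    define P where "P = (\<lambda>x. (x, r)) ` D"
    have "P \<in> packings \<delta> A"
      using D(1-3) r(1,2) by (auto simp: packings_def P_def disjoint_family_on_def pairwise_def disjnt_def)
    then have "(\<Sum>\<^sub>\<infinity>(x, r)\<in>P. ennreal ((2 * r) powr s)) \<le> packing_pre s \<delta> A"
      unfolding packing_pre_def by (rule SUP_upper)
    also have "(\<Sum>\<^sub>\<infinity>(x, r)\<in>P. ennreal ((2 * r) powr s)) = (\<Sum>\<^sub>\<infinity>x\<in>D. ennreal ((2 * r) powr s))"
      unfolding P_def by (subst infsum_reindex) (auto simp: inj_on_def o_def)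
    finally have packed: "(\<Sum>\<^sub>\<infinity>x\<in>D. ennreal ((2 * r) powr s)) \<le> packing_pre s \<delta> A" .
    show ?thesis
    proof (cases "finite D")
      case True
      have "outer_measure_of M A \<le> outer_measure_of M (\<Union>i\<in>D. cball i (5 * r))"
        using D(4) by (intro outer_measure_of_mono) auto
      also have "\<dots> = emeasure M (\<Union>i\<in>D. cball i (5 * r))"
        using True by (intro outer_measure_of_eq) auto
      also have "\<dots> \<le> (\<Sum>i\<in>D. emeasure M (cball i (5 * r)))"
        using True by (intro emeasure_subadditive_finite) auto
      also have "\<dots> \<le> (\<Sum>i\<in>D. ennreal (C * r powr s))"
        using r(3) by (intro sum_mono) auto
      also have "\<dots> = (\<Sum>i\<in>D. ennreal C' * ennreal ((2 * r) powr s))"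
        using \<open>0 < C\<close> r(1) by (intro sum.cong) (auto simp: C'_def ennreal_mult[symmetric] powr_mult)
      also have "\<dots> = ennreal C' * (\<Sum>\<^sub>\<infinity>x\<in>D. ennreal ((2 * r) powr s))"
        using True by (simp only: infsum_finite sum_distrib_left)
      also have "\<dots> \<le> ennreal C' * packing_pre s \<delta> A"
        using packed by (intro mult_left_mono) auto
      finally show ?thesis .
    next
      case False
      have "(\<Sum>\<^sub>\<infinity>x\<in>D. ennreal ((2 * r) powr s)) = \<infinity>"
        using False r(1) by (intro infsum_superconst_infinite_ennreal[where b="ennreal ((2 * r) powr s)"]) auto
      then have "packing_pre s \<delta> A = \<infinity>" using packed by (simp add: top_unique)
      then show ?thesis using \<open>0 < C'\<close> by (simp add: ennreal_mult_top)
    qed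
  qed
  have prem: "outer_measure_of M A / ennreal C' \<le> packing_premeasure s A" for A
    unfolding packing_premeasure_def
  proof (rule INF_greatest)
    fix \<delta> :: real assume "\<delta> \<in> {0<..}"
    then show "outer_measure_of M A / ennreal C' \<le> packing_pre s \<delta> A"
      using pre[of \<delta> A] \<open>0 < C'\<close> by (intro divide_le_posI_ennreal) (simp_all add: mult.commute)
  qed
  have "emeasure M E / ennreal C' \<le> packing_measure s E"
    unfolding packing_measure_def
  proof (rule INF_greatest, clarify)
    fix A :: "nat \<Rightarrow> 'a set" assume A: "E \<subseteq> \<Union> (range A)"
    obtain V where V: "\<And>i. V i \<in> sets M" "\<And>i. A i \<subseteq> V i" "\<And>i. outer_measure_of M (A i) = emeasure M (V i)"
      using outer_measure_of_attain[of "A _" M] sp by (metis subset_UNIV)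
    have "emeasure M E \<le> emeasure M (\<Union>i. V i)"
      using A V(1,2) by (intro emeasure_mono sets.countable_UN) blast+
    also have "\<dots> \<le> (\<Sum>i. emeasure M (V i))"
      using V(1) by (intro emeasure_subadditive_countably) auto
    finally have "emeasure M E / ennreal C' \<le> (\<Sum>i. outer_measure_of M (A i)) / ennreal C'"
      by (simp add: V(3) divide_right_mono_ennreal)
    also have "\<dots> = (\<Sum>i. outer_measure_of M (A i) / ennreal C')"
      by (simp add: divide_ennreal_def)
    also have "\<dots> \<le> (\<Sum>i. packing_premeasure s (A i))"
      using prem by (intro suminf_le summableI) auto
    finally show "emeasure M E / ennreal C' \<le> (\<Sum>i. packing_premeasure s (A i))" .
  qed
  moreover have "emeasure M E / ennreal C' > 0"
    using E(2) by (simp add: ennreal_zero_less_divide)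
  ultimately show ?thesis by auto
qed

section \<open>Dense subspaces of square integrable functions\<close>

text \<open>Membership in the closure of \<open>V\<close>, in terms of squared distances:
  \<open>cmod_add_sq_le\<close> then replaces the triangle inequality at the cost of a factor
  2.\<close>

definition L2_approx :: "'a measure \<Rightarrow> ('a \<Rightarrow> complex) set \<Rightarrow> ('a \<Rightarrow> complex) \<Rightarrow> bool" where
  "L2_approx M V f \<longleftrightarrow> f \<in> L2_space M \<and> (\<forall>e>0. \<exists>v\<in>V. (LINT x|M. (cmod (f x - v x))\<^sup>2) < e)"

lemma cmod_add_sq_le: "(cmod (a + b))\<^sup>2 \<le> 2 * (cmod a)\<^sup>2 + 2 * (cmod b)\<^sup>2"
proof -
  have "(cmod (a + b))\<^sup>2 \<le> (cmod a + cmod b)\<^sup>2"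
    by (intro power_mono norm_triangle_ineq) auto
  also have "\<dots> \<le> 2 * (cmod a)\<^sup>2 + 2 * (cmod b)\<^sup>2"
    using sum_squares_bound[of "cmod a" "cmod b"] by (simp add: power2_sum)
  finally show ?thesis .
qed

lemma L2_space_add: "f \<in> L2_space M \<Longrightarrow> g \<in> L2_space M \<Longrightarrow> (\<lambda>x. f x + g x) \<in> L2_space M"
proof -
  assume fg: "f \<in> L2_space M" "g \<in> L2_space M"
  then have [measurable]: "f \<in> borel_measurable M" "g \<in> borel_measurable M" by (auto simp: L2_space_def)
  have "integrable M (\<lambda>x. 2 * (cmod (f x))\<^sup>2 + 2 * (cmod (g x))\<^sup>2)" using fg by (auto simp: L2_space_def)
  then have "integrable M (\<lambda>x. (cmod (f x + g x))\<^sup>2)"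
    by (rule Bochner_Integration.integrable_bound) (auto intro!: AE_I2 order_trans[OF cmod_add_sq_le])
  then show ?thesis by (simp add: L2_space_def)
qed

lemma L2_space_cmult: "f \<in> L2_space M \<Longrightarrow> (\<lambda>x. c * f x) \<in> L2_space M"
  by (auto simp: L2_space_def norm_mult power_mult_distrib)

lemma L2_space_diff: "f \<in> L2_space M \<Longrightarrow> g \<in> L2_space M \<Longrightarrow> (\<lambda>x. f x - g x) \<in> L2_space M"
  using L2_space_add[of f M "\<lambda>x. (-1) * g x"] L2_space_cmult[of g M "-1"] by simp

lemma integral_cmod_add_sq_le:
  assumes "f \<in> L2_space M" "g \<in> L2_space M"
  shows "(LINT x|M. (cmod (f x + g x))\<^sup>2) \<le> 2 * (LINT x|M. (cmod (f x))\<^sup>2) + 2 * (LINT x|M. (cmod (g x))\<^sup>2)"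
proof -
  have "(LINT x|M. (cmod (f x + g x))\<^sup>2) \<le> (LINT x|M. 2 * (cmod (f x))\<^sup>2 + 2 * (cmod (g x))\<^sup>2)"
    using assms L2_space_add[OF assms]
    by (intro integral_mono cmod_add_sq_le) (auto simp: L2_space_def)
  also have "\<dots> = 2 * (LINT x|M. (cmod (f x))\<^sup>2) + 2 * (LINT x|M. (cmod (g x))\<^sup>2)"
    using assms by (simp add: L2_space_def)
  finally show ?thesis .
qed

locale L2_subspace = prob_space M for M :: "'a measure" +
  fixes V :: "('a \<Rightarrow> complex) set"
  assumes V_L2: "v \<in> V \<Longrightarrow> v \<in> L2_space M"
    and V_zero: "(\<lambda>_. 0) \<in> V"
    and V_add: "v \<in> V \<Longrightarrow> w \<in> V \<Longrightarrow> (\<lambda>x. v x + w x) \<in> V"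
    and V_cmult: "v \<in> V \<Longrightarrow> (\<lambda>x. c * v x) \<in> V"
begin

lemma approx_add:
  assumes "L2_approx M V f" "L2_approx M V g"
  shows "L2_approx M V (\<lambda>x. f x + g x)"
  unfolding L2_approx_def
proof (intro conjI allI impI)
  have fg: "f \<in> L2_space M" "g \<in> L2_space M" using assms by (auto simp: L2_approx_def)
  then show "(\<lambda>x. f x + g x) \<in> L2_space M" by (rule L2_space_add)
  fix e :: real assume "0 < e"
  then have "0 < e / 4" by simp
  with assms have "\<exists>v\<in>V. (LINT x|M. (cmod (f x - v x))\<^sup>2) < e / 4"
      "\<exists>w\<in>V. (LINT x|M. (cmod (g x - w x))\<^sup>2) < e / 4"
    unfolding L2_approx_def by blast+
  then obtain v w where vw: "v \<in> V" "w \<in> V" "(LINT x|M. (cmod (f x - v x))\<^sup>2) < e / 4"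
      "(LINT x|M. (cmod (g x - w x))\<^sup>2) < e / 4"
    by (elim bexE)
  have "(LINT x|M. (cmod (f x + g x - (v x + w x)))\<^sup>2) = (LINT x|M. (cmod ((f x - v x) + (g x - w x)))\<^sup>2)"
    by (simp add: algebra_simps)
  also have "\<dots> \<le> 2 * (LINT x|M. (cmod (f x - v x))\<^sup>2) + 2 * (LINT x|M. (cmod (g x - w x))\<^sup>2)"
    using fg V_L2[OF vw(1)] V_L2[OF vw(2)] by (intro integral_cmod_add_sq_le L2_space_diff)
  also have "\<dots> < e" using vw by simp
  finally show "\<exists>v\<in>V. (LINT x|M. (cmod (f x + g x - v x))\<^sup>2) < e"
    by (intro bexI[OF _ V_add[OF vw(1,2)]])
qed

lemma approx_cmult:
  assumes "L2_approx M V f"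
  shows "L2_approx M V (\<lambda>x. c * f x)"
  unfolding L2_approx_def
proof (intro conjI allI impI)
  show "(\<lambda>x. c * f x) \<in> L2_space M" using assms by (simp add: L2_approx_def L2_space_cmult)
  fix e :: real assume "0 < e"
  then have "e / ((cmod c)\<^sup>2 + 1) > 0" by (simp add: add_nonneg_pos)
  then obtain v where v: "v \<in> V" "(LINT x|M. (cmod (f x - v x))\<^sup>2) < e / ((cmod c)\<^sup>2 + 1)"
    using assms unfolding L2_approx_def by blast
  have "(LINT x|M. (cmod (c * f x - c * v x))\<^sup>2) = (cmod c)\<^sup>2 * (LINT x|M. (cmod (f x - v x))\<^sup>2)"
    unfolding right_diff_distrib[symmetric] by (simp add: norm_mult power_mult_distrib)
  also have "\<dots> \<le> ((cmod c)\<^sup>2 + 1) * (LINT x|M. (cmod (f x - v x))\<^sup>2)"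
    by (intro mult_right_mono) auto
  also have "\<dots> < e"
    using v(2) by (subst (asm) pos_less_divide_eq) (auto simp: add_nonneg_pos mult.commute)
  finally show "\<exists>v\<in>V. (LINT x|M. (cmod (c * f x - v x))\<^sup>2) < e"
    by (intro bexI[OF _ V_cmult[OF v(1)]])
qed

lemma approx_limit:
  assumes f: "f \<in> L2_space M" and lim: "\<And>e. 0 < e \<Longrightarrow> \<exists>g. L2_approx M V g \<and> (LINT x|M. (cmod (f x - g x))\<^sup>2) < e"
  shows "L2_approx M V f"
  unfolding L2_approx_def
proof (intro conjI allI impI f)
  fix e :: real assume "0 < e"
  then obtain g where g: "L2_approx M V g" "(LINT x|M. (cmod (f x - g x))\<^sup>2) < e / 4"
    using lim[of "e / 4"] by auto
  then obtain v where v: "v \<in> V" "(LINT x|M. (cmod (g x - v x))\<^sup>2) < e / 4"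
    using \<open>0 < e\<close> unfolding L2_approx_def by (meson half_gt_zero_iff zero_less_divide_iff zero_less_numeral)
  have "(LINT x|M. (cmod (f x - v x))\<^sup>2) = (LINT x|M. (cmod ((f x - g x) + (g x - v x)))\<^sup>2)" by simp
  also have "\<dots> \<le> 2 * (LINT x|M. (cmod (f x - g x))\<^sup>2) + 2 * (LINT x|M. (cmod (g x - v x))\<^sup>2)"
    using f g(1) V_L2[OF v(1)] by (intro integral_cmod_add_sq_le L2_space_diff) (auto simp: L2_approx_def)
  also have "\<dots> < e" using g v by simp
  finally show "\<exists>v\<in>V. (LINT x|M. (cmod (f x - v x))\<^sup>2) < e" using v(1) by blast
qed

lemma approx_zero: "L2_approx M V (\<lambda>_. 0)"
  using V_zero by (auto simp: L2_approx_def V_L2 intro!: bexI[OF _ V_zero])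

lemma approx_sum:
  assumes "finite I" "\<And>i. i \<in> I \<Longrightarrow> L2_approx M V (f i)"
  shows "L2_approx M V (\<lambda>x. \<Sum>i\<in>I. f i x)"
  using assms by (induction I rule: finite_induct) (auto intro: approx_add approx_zero)

lemma indicator_L2: "A \<in> sets M \<Longrightarrow> (\<lambda>x. indicator A x :: complex) \<in> L2_space M"
  unfolding L2_space_def
  by (intro CollectI conjI integrable_const_bound[of _ 1] AE_I2) (auto simp: indicator_def)

text \<open>The sets with approximable indicator form a Dynkin system, which contains the whole
  sigma-algebra since \<open>G\<close> is stable under intersection; simple functions and dominated
  convergence do the rest.\<close>

lemma dense_if_generator_approx:
  assumes G: "Int_stable G" "G \<subseteq> sets M" "sets M = sigma_sets (space M) G"
    and gen: "\<And>A. A \<in> G \<Longrightarrow> L2_approx M V (indicator A)"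
    and top: "L2_approx M V (\<lambda>_. 1)"
    and f: "f \<in> L2_space M"
  shows "L2_approx M V f"
proof -
  have ind: "L2_approx M V (indicator A)" if "A \<in> sets M" for A
  proof -
    note G(1)
    moreover have "G \<subseteq> Pow (space M)" using G(2) sets.sets_into_space by blast
    moreover have "A \<in> sigma_sets (space M) G" using that G(3) by simp
    ultimately show ?thesis
    proof (induction rule: sigma_sets_induct_disjoint)
      case (basic A)
      then show ?case by (rule gen)
    next
      case empty
      then show ?case using approx_zero by (simp add: indicator_def)
    next
      case (compl A)
      have "L2_approx M V (\<lambda>x. 1 + (-1) * indicator A x)"
        by (intro approx_add approx_cmult top compl.IH)
      moreover have "indicator (space M - A) x = 1 + (-1) * (indicator A x :: complex)" if "x \<in> space M" for x
        using that by (auto simp: indicator_def)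
      moreover have "A \<in> sets M" using compl.hyps G(3) by simp
      then have "(indicator (space M - A) :: 'a \<Rightarrow> complex) \<in> L2_space M"
        using indicator_L2[of "space M - A"] by blast
      ultimately show ?case
        by (auto simp: L2_approx_def cong: Bochner_Integration.integral_cong)
    next
      case (union A)
      have Am: "A i \<in> sets M" for i using union(2) G(3) by auto
      have U: "(\<Union>i. A i) \<in> sets M" using Am by auto
      show ?case
      proof (rule approx_limit)
        show "indicator (\<Union>i. A i) \<in> L2_space M" using indicator_L2[OF U] by simp
        fix e :: real assume "0 < e"
        have "(\<lambda>n. \<Sum>i<n. prob (A i)) \<longlonglongrightarrow> prob (\<Union>i. A i)"
          using finite_measure_UNION[of A] Am union(1) by (auto simp: sums_def)
        then have "\<forall>\<^sub>F n in sequentially. dist (\<Sum>i<n. prob (A i)) (prob (\<Union>i. A i)) < e"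
          using \<open>0 < e\<close> by (rule tendstoD)
        then obtain n where n: "dist (\<Sum>i<n. prob (A i)) (prob (\<Union>i. A i)) < e"
          by (auto simp: eventually_sequentially)
        \<comment> \<open>The first \<open>n\<close> of the disjoint sets: the squared distance
          between the two indicators is the probability of the remaining ones.\<close>
        define B where "B = (\<Union>i<n. A i)"
        have B: "B \<in> sets M" "B \<subseteq> (\<Union>i. A i)" using Am by (auto simp: B_def)
        have probB: "prob B = (\<Sum>i<n. prob (A i))"
          unfolding B_def using Am union(1)
          by (intro finite_measure_finite_Union) (auto simp: disjoint_family_on_def)
        have eq: "(\<Sum>i<n. indicator (A i) x) = (indicator B x :: complex)" for x
          unfolding B_def using union(1)
          by (subst indicator_UN_disjoint) (auto simp: disjoint_family_on_def)
        have "L2_approx M V (\<lambda>x. \<Sum>i<n. indicator (A i) x)"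
          by (intro approx_sum) (use union(3) in auto)
        then have "L2_approx M V (indicator B)" by (simp add: eq)
        moreover have "(LINT x|M. (cmod (indicator (\<Union>i. A i) x - indicator B x))\<^sup>2) = (LINT x|M. indicator ((\<Union>i. A i) - B) x)"
          using B(2) by (intro Bochner_Integration.integral_cong) (auto simp: indicator_def)
        moreover have "\<dots> = prob (\<Union>i. A i) - prob B"
          using U B by (simp add: finite_measure_Diff)
        moreover have "\<dots> < e" using n probB by (simp add: dist_real_def)
        ultimately show "\<exists>g. L2_approx M V g \<and> (LINT x|M. (cmod (indicator (\<Union>i. A i) x - g x))\<^sup>2) < e"
          by metis
      qed
    qed
  qed
  have simple: "L2_approx M V g" if g: "simple_function M g" for g :: "'a \<Rightarrow> complex"
  proof -
    have "L2_approx M V (\<lambda>x. \<Sum>y\<in>g ` space M. y * indicator (g -` {y} \<inter> space M) x)"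
      using g by (intro approx_sum approx_cmult ind) (auto simp: simple_function_def)
    moreover have "(\<Sum>y\<in>g ` space M. y * indicator (g -` {y} \<inter> space M) x) = g x" if "x \<in> space M" for x
    proof -
      have "(\<Sum>y\<in>g ` space M. y * indicator (g -` {y} \<inter> space M) x) = (\<Sum>y\<in>{g x}. y * indicator (g -` {y} \<inter> space M) x)"
        using g that by (intro sum.mono_neutral_right) (auto simp: simple_function_def indicator_def)
      then show ?thesis using that by simp
    qed
    ultimately show ?thesis
      using borel_measurable_simple_function[OF g]
      by (auto simp: L2_approx_def L2_space_def cong: Bochner_Integration.integral_cong Bochner_Integration.integrable_cong)
  qed
  have [measurable]: "f \<in> borel_measurable M" and fint: "integrable M (\<lambda>x. (cmod (f x))\<^sup>2)"
    using f by (auto simp: L2_space_def)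
  obtain s where s: "\<And>i. simple_function M (s i)" "\<And>x. x \<in> space M \<Longrightarrow> (\<lambda>i. s i x) \<longlonglongrightarrow> f x"
    "\<And>i x. x \<in> space M \<Longrightarrow> cmod (s i x) \<le> 2 * cmod (f x)"
    using borel_measurable_implies_sequence_metric[of f M 0] unfolding dist_0_norm
    by (metis \<open>f \<in> borel_measurable M\<close> dist_0_norm dist_commute)
  have [measurable]: "s i \<in> borel_measurable M" for i by (rule borel_measurable_simple_function[OF s(1)])
  have "(\<lambda>i. LINT x|M. (cmod (f x - s i x))\<^sup>2) \<longlonglongrightarrow> (LINT x|M. 0)"
  proof (rule integral_dominated_convergence)
    \<comment> \<open>The approximants satisfy \<open>cmod (s i x) \<le> 2 * cmod (f x)\<close>, and
      9 is the square of 1 + 2.\<close>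
    show "integrable M (\<lambda>x. 9 * (cmod (f x))\<^sup>2)" using fint by simp
    show "AE x in M. (\<lambda>i. (cmod (f x - s i x))\<^sup>2) \<longlonglongrightarrow> 0"
    proof (rule AE_I2)
      fix x assume "x \<in> space M"
      then have "(\<lambda>i. (cmod (f x - s i x))\<^sup>2) \<longlonglongrightarrow> (cmod (f x - f x))\<^sup>2"
        by (intro tendsto_intros s)
      then show "(\<lambda>i. (cmod (f x - s i x))\<^sup>2) \<longlonglongrightarrow> 0" by simp
    qed
    show "AE x in M. norm ((cmod (f x - s i x))\<^sup>2) \<le> 9 * (cmod (f x))\<^sup>2" for i
    proof (rule AE_I2)
      fix x assume "x \<in> space M"
      then have "cmod (f x - s i x) \<le> 3 * cmod (f x)"
        using s(3)[of x i] norm_triangle_ineq4[of "f x" "s i x"] by simp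
      then have "(cmod (f x - s i x))\<^sup>2 \<le> (3 * cmod (f x))\<^sup>2" by (intro power_mono) auto
      then show "norm ((cmod (f x - s i x))\<^sup>2) \<le> 9 * (cmod (f x))\<^sup>2" by (simp add: power_mult_distrib)
    qed
  qed auto
  then have lim: "(\<lambda>i. LINT x|M. (cmod (f x - s i x))\<^sup>2) \<longlonglongrightarrow> 0" by simp
  show ?thesis
  proof (rule approx_limit[OF f])
    fix e :: real assume "0 < e"
    then have "\<forall>\<^sub>F i in sequentially. (LINT x|M. (cmod (f x - s i x))\<^sup>2) < e"
      using lim by (rule order_tendstoD(2)[rotated])
    then obtain i where "(LINT x|M. (cmod (f x - s i x))\<^sup>2) < e" by (auto simp: eventually_sequentially)
    then show "\<exists>g. L2_approx M V g \<and> (LINT x|M. (cmod (f x - g x))\<^sup>2) < e"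
      using simple[OF s(1)] by blast
  qed
qed

end

section \<open>Fair coin tossing\<close>

definition coin :: "(nat \<Rightarrow> bool) measure" where
  "coin = PiM UNIV (\<lambda>_. measure_pmf (bernoulli_pmf (1/2)))"

lemma prob_space_coin: "prob_space coin"
  unfolding coin_def by (intro prob_space_PiM) (simp add: measure_pmf.prob_space_axioms)

interpretation coin: prob_space coin
  by (rule prob_space_coin)

lemma space_coin [simp]: "space coin = UNIV"
  by (simp add: coin_def space_PiM)

lemma measurable_coin_component [measurable]: "(\<lambda>w. w i) \<in> measurable coin (count_space UNIV)"
proof -
  have "(\<lambda>w. w i) \<in> measurable coin (measure_pmf (bernoulli_pmf (1/2)))"
    unfolding coin_def by (rule measurable_component_singleton) simp
  then show ?thesis by simp
qed

lemma sets_coin_Collect [measurable]: "{w. w i \<in> A} \<in> sets coin"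
  using measurable_sets[OF measurable_coin_component, of A i] by (simp add: vimage_def)

lemma measurable_coin_target:
  assumes "\<And>i. (\<lambda>x. f x i) \<in> measurable M (count_space UNIV)"
  shows "f \<in> measurable M coin"
  unfolding coin_def
proof (rule measurable_PiM_single')
  fix i :: nat
  show "(\<lambda>x. f x i) \<in> measurable M (measure_pmf (bernoulli_pmf (1/2)))"
    using assms[of i] by (simp cong: measurable_cong_sets)
qed (simp add: PiE_def)

lemma measurable_coin_update [measurable]: "(\<lambda>w. w(j := v)) \<in> measurable coin coin"
  by (rule measurable_coin_target) (simp add: fun_upd_def)

lemma measurable_coin_flip [measurable]: "(\<lambda>w. w(j := \<not> w j)) \<in> measurable coin coin"
  by (rule measurable_coin_target) (simp add: fun_upd_def)

lemma sets_coin_cylinder: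
  assumes "finite J"
  shows "{w. \<forall>i\<in>J. w i \<in> F i} \<in> sets coin"
  using sets.sets_Collect_finite_All[of J coin "\<lambda>i w. w i \<in> F i"] assms by simp

lemma emeasure_coin_Collect:
  assumes "finite J"
  shows "emeasure coin {w. \<forall>i\<in>J. w i \<in> F i} = (\<Prod>i\<in>J. emeasure (measure_pmf (bernoulli_pmf (1/2))) (F i))"
proof -
  interpret product_prob_space "\<lambda>_::nat. measure_pmf (bernoulli_pmf (1/2))" UNIV
    by unfold_locales
  show ?thesis using emeasure_PiM_Collect[of J F] assms by (simp add: space_PiM flip: coin_def)
qed

lemma emeasure_bernoulli_half_flip:
  "emeasure (measure_pmf (bernoulli_pmf (1/2))) {b. (\<not> b) \<in> A} = emeasure (measure_pmf (bernoulli_pmf (1/2))) A"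
proof -
  have E: "emeasure (measure_pmf (bernoulli_pmf (1/2))) S = ennreal (real (card S) * (1/2))" for S :: "bool set"
  proof -
    have "pmf (bernoulli_pmf (1/2)) b = 1/2" for b by (cases b) auto
    then show ?thesis by (simp add: emeasure_measure_pmf_finite)
  qed
  have "card (Not -` A) = card A" by (rule card_vimage_inj) (auto simp: inj_on_def)
  then have "card {b. (\<not> b) \<in> A} = card A" by (simp add: vimage_def)
  then show ?thesis by (simp add: E)
qed

text \<open>The product measure is determined by its cylinders, and the flip only exchanges two
  equally likely outcomes in factor \<open>j\<close>.\<close>

lemma coin_flip: "distr coin coin (\<lambda>w. w(j := \<not> w j)) = coin"
proof -
  interpret product_prob_space "\<lambda>_::nat. measure_pmf (bernoulli_pmf (1/2))" UNIV
    by unfold_locales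
  show ?thesis unfolding coin_def
  proof (rule PiM_eq, unfold coin_def[symmetric])
    show "sets (distr coin coin (\<lambda>w. w(j := \<not> w j))) = sets coin" by simp
    fix J :: "nat set" and F :: "nat \<Rightarrow> bool set"
    assume J: "finite J"
    define F' where "F' i = (if i = j then {b. (\<not> b) \<in> F i} else F i)" for i
    have emb: "prod_emb UNIV (\<lambda>_. measure_pmf (bernoulli_pmf (1/2))) J (PiE J F) = {w. \<forall>i\<in>J. w i \<in> F i}" for F :: "nat \<Rightarrow> bool set"
      by (auto simp: prod_emb_def PiE_def Pi_def extensional_def)
    have "w(j := \<not> w j) \<in> {w. \<forall>i\<in>J. w i \<in> F i} \<longleftrightarrow> w \<in> {w. \<forall>i\<in>J. w i \<in> F' i}" for w
      unfolding mem_Collect_eq by (intro ball_cong) (simp_all add: F'_def)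
    then have cyl: "(\<lambda>w. w(j := \<not> w j)) -` {w. \<forall>i\<in>J. w i \<in> F i} = {w. \<forall>i\<in>J. w i \<in> F' i}"
      by (simp only: set_eq_iff vimage_eq simp_thms)
    have "emeasure (distr coin coin (\<lambda>w. w(j := \<not> w j))) {w. \<forall>i\<in>J. w i \<in> F i}
        = emeasure coin {w. \<forall>i\<in>J. w i \<in> F' i}"
      by (rule trans[OF emeasure_distr[OF measurable_coin_flip sets_coin_cylinder[OF J]]]) (simp only: cyl space_coin Int_UNIV_right)
    also have "\<dots> = (\<Prod>i\<in>J. emeasure (measure_pmf (bernoulli_pmf (1/2))) (F i))"
      unfolding emeasure_coin_Collect[OF J] by (intro prod.cong) (auto simp: F'_def emeasure_bernoulli_half_flip)
    finally show "emeasure (distr coin coin (\<lambda>w. w(j := \<not> w j)))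
        (prod_emb UNIV (\<lambda>_. measure_pmf (bernoulli_pmf (1/2))) J (PiE J F)) =
        (\<Prod>i\<in>J. emeasure (measure_pmf (bernoulli_pmf (1/2))) (F i))"
      unfolding emb .
  qed
qed

lemma integral_coin_flip:
  fixes f :: "(nat \<Rightarrow> bool) \<Rightarrow> 'b::{banach, second_countable_topology}"
  assumes [measurable]: "f \<in> borel_measurable coin"
  shows "(LINT w|coin. f (w(j := \<not> w j))) = (LINT w|coin. f w)"
  using integral_distr[of "\<lambda>w. w(j := \<not> w j)" coin coin f] by (simp add: coin_flip)

section \<open>Conditioning on finitely many coins\<close>

definition set_prefix :: "nat \<Rightarrow> nat set \<Rightarrow> (nat \<Rightarrow> bool) \<Rightarrow> nat \<Rightarrow> bool" where
  "set_prefix n F w = (\<lambda>k. if k < n then k \<in> F else w k)"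

lemma measurable_set_prefix [measurable]: "set_prefix n F \<in> measurable coin coin"
  unfolding set_prefix_def by (rule measurable_coin_target) simp

text \<open>All \<open>2 ^ n\<close> prefixes are equally likely. Overwriting coins in place avoids
  splitting the product space into prefix and remainder; the bound \<open>B\<close> provides
  integrability.\<close>

lemma integral_coin_prefix:
  fixes f :: "(nat \<Rightarrow> bool) \<Rightarrow> 'b::{banach, second_countable_topology}"
  assumes "f \<in> borel_measurable coin" "\<And>w. norm (f w) \<le> B"
  shows "(LINT w|coin. f w) = (\<Sum>F\<in>Pow {..<n}. LINT w|coin. f (set_prefix n F w)) /\<^sub>R 2 ^ n"
proof (induction n)
  case 0
  have "set_prefix 0 {} w = w" for w by (simp add: set_prefix_def)
  then show ?case by simp
next
  case (Suc n)
  note [measurable] = assms(1)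
  \<comment> \<open>Of \<open>w\<close> and its flip at \<open>n\<close>, one is
    \<open>w(n := True)\<close> and the other \<open>w(n := False)\<close>; by flip invariance
    \<open>g\<close> has the same integral before and after the flip.\<close>
  have half: "(LINT w|coin. g w) = ((LINT w|coin. g (w(n := True))) + (LINT w|coin. g (w(n := False)))) /\<^sub>R 2"
    if [measurable]: "g \<in> borel_measurable coin" and b: "\<And>w. norm (g w) \<le> B" for g :: "(nat \<Rightarrow> bool) \<Rightarrow> 'b"
  proof -
    have int: "integrable coin (\<lambda>w. g (h w))" if [measurable]: "h \<in> measurable coin coin" for h
      by (rule coin.integrable_const_bound[of _ B]) (auto simp: b)
    have "(LINT w|coin. g w) + (LINT w|coin. g (w(n := \<not> w n))) =
        (LINT w|coin. g w + g (w(n := \<not> w n)))"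
      using int[of "\<lambda>w. w"] int[of "\<lambda>w. w(n := \<not> w n)"] by simp
    also have "\<dots> = (LINT w|coin. g (w(n := True)) + g (w(n := False)))"
    proof (rule Bochner_Integration.integral_cong[OF refl])
      fix w show "g w + g (w(n := \<not> w n)) = g (w(n := True)) + g (w(n := False))"
        using fun_upd_triv[of w n] by (cases "w n") (auto simp: add.commute)
    qed
    also have "\<dots> = (LINT w|coin. g (w(n := True))) + (LINT w|coin. g (w(n := False)))"
      using int[of "\<lambda>w. w(n := True)"] int[of "\<lambda>w. w(n := False)"] by simp
    finally have "2 *\<^sub>R (LINT w|coin. g w) = (LINT w|coin. g (w(n := True))) + (LINT w|coin. g (w(n := False)))"
      by (simp add: integral_coin_flip scaleR_2)
    from this[symmetric] show ?thesis by simp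
  qed
  have split: "(LINT w|coin. f (set_prefix n F w)) =
     ((LINT w|coin. f (set_prefix n F (w(n := True)))) + (LINT w|coin. f (set_prefix n F (w(n := False))))) /\<^sub>R 2" for F
    by (rule half) (simp_all add: assms(2))
  have T: "set_prefix n F (w(n := True)) = set_prefix (Suc n) (insert n F) w"
    and F: "F \<in> Pow {..<n} \<Longrightarrow> set_prefix n F (w(n := False)) = set_prefix (Suc n) F w" for F w
    by (auto simp: set_prefix_def fun_eq_iff less_Suc_eq)
  define H where "H m F = (LINT w|coin. f (set_prefix m F w))" for m F
  have H: "H n F = (H (Suc n) (insert n F) + H (Suc n) F) /\<^sub>R 2" if "F \<in> Pow {..<n}" for F
    using split[of F] unfolding H_def T F[OF that] .
  have inj: "inj_on (insert n) (Pow {..<n})"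
  proof (rule inj_onI)
    fix A B assume "A \<in> Pow {..<n}" "B \<in> Pow {..<n}" "insert n A = insert n B"
    then have "insert n A - {n} = insert n B - {n}" "n \<notin> A" "n \<notin> B" by auto
    then show "A = B" by simp
  qed
  have disj: "Pow {..<n} \<inter> insert n ` Pow {..<n} = {}" by auto
  have "sum (H n) (Pow {..<n}) = (\<Sum>F\<in>Pow {..<n}. (H (Suc n) (insert n F) + H (Suc n) F) /\<^sub>R 2)"
    by (rule sum.cong[OF refl H])
  also have "\<dots> = ((\<Sum>F\<in>Pow {..<n}. H (Suc n) (insert n F)) + sum (H (Suc n)) (Pow {..<n})) /\<^sub>R 2"
    by (simp only: sum.distrib scaleR_sum_right[symmetric])
  also have "(\<Sum>F\<in>Pow {..<n}. H (Suc n) (insert n F)) = sum (H (Suc n)) (insert n ` Pow {..<n})"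
    by (simp only: sum.reindex[OF inj] o_def)
  also have "\<dots> + sum (H (Suc n)) (Pow {..<n}) = sum (H (Suc n)) (Pow {..<Suc n})"
    unfolding lessThan_Suc Pow_insert
    by (subst sum.union_disjoint[OF _ _ disj]) (simp_all add: add.commute)
  finally have "sum (H n) (Pow {..<n}) /\<^sub>R 2 ^ n = sum (H (Suc n)) (Pow {..<Suc n}) /\<^sub>R 2 ^ Suc n"
    by (simp add: mult.commute)
  with Suc show ?case unfolding H_def by simp
qed

lemma emeasure_coin_cylinder: "emeasure coin {w. \<forall>k<n. w k = (k \<in> F)} = ennreal ((1/2) ^ n)"
proof -
  have "emeasure coin {w. \<forall>k<n. w k = (k \<in> F)} = (\<Prod>i<n. emeasure (measure_pmf (bernoulli_pmf (1/2))) {i \<in> F})"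
    using emeasure_coin_Collect[of "{..<n}" "\<lambda>i. {i \<in> F}"] by (simp only: finite_lessThan lessThan_iff Ball_def singleton_iff)
  also have "\<dots> = (\<Prod>i<n. ennreal (1/2))"
    by (intro prod.cong) (auto simp: emeasure_pmf_single)
  also have "\<dots> = ennreal ((1/2) ^ n)"
    by (subst prod_ennreal) (simp_all only: prod_constant card_lessThan)
  finally show ?thesis .
qed

text \<open>One implication suffices, since \<open>w\<close> and \<open>w'\<close> can be
  exchanged.\<close>

definition determined :: "nat \<Rightarrow> (nat \<Rightarrow> bool) set \<Rightarrow> bool" where
  "determined n A \<longleftrightarrow> (\<forall>w w'. (\<forall>k<n. w k = w' k) \<longrightarrow> w \<in> A \<longrightarrow> w' \<in> A)"

lemma determinedD: "determined n A \<Longrightarrow> w \<in> A \<Longrightarrow> (\<And>k. k < n \<Longrightarrow> w k = w' k) \<Longrightarrow> w' \<in> A"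
  unfolding determined_def by blast

lemma determined_mono: "determined m A \<Longrightarrow> m \<le> n \<Longrightarrow> determined n A"
  unfolding determined_def proof (intro allI impI)
  fix w w'
  assume "\<forall>w w'. (\<forall>k<m. w k = w' k) \<longrightarrow> w \<in> A \<longrightarrow> w' \<in> A" "m \<le> n" "\<forall>k<n. w k = w' k" "w \<in> A"
  moreover from this have "\<forall>k<m. w k = w' k" by simp
  ultimately show "w' \<in> A" by blast
qed

lemma Int_stable_determined: "Int_stable {A. \<exists>n. determined n A}"
proof (rule Int_stableI, clarify)
  fix A B m n assume "determined m A" "determined n B"
  then have "determined (max m n) A" "determined (max m n) B" by (auto intro: determined_mono)
  then have "determined (max m n) (A \<inter> B)" unfolding determined_def by blast
  then show "\<exists>n. determined n (A \<inter> B)" ..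
qed

text \<open>A finite union of cylinders, one for each prefix that \<open>A\<close> admits; a prefix
  is represented by the sequence that continues it with \<open>False\<close>.\<close>

lemma determined_sets:
  assumes "determined n A"
  shows "A \<in> sets coin"
proof -
  define C where "C F = {w :: nat \<Rightarrow> bool. \<forall>k\<in>{..<n}. w k \<in> {k \<in> F}}" for F
  define I where "I = {F \<in> Pow {..<n}. (\<lambda>k. k \<in> F) \<in> A}"
  have "w \<in> A \<longleftrightarrow> (\<exists>F\<in>I. w \<in> C F)" for w
  proof
    assume w: "w \<in> A"
    define F where "F = {k. k < n \<and> w k}"
    have "(\<lambda>k. k \<in> F) \<in> A" by (rule determinedD[OF assms w]) (simp add: F_def)
    moreover have "w \<in> C F" by (simp add: C_def F_def)
    moreover have "F \<in> Pow {..<n}" by (auto simp: F_def)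
    ultimately show "\<exists>F\<in>I. w \<in> C F" unfolding I_def by blast
  next
    assume "\<exists>F\<in>I. w \<in> C F"
    then obtain F where F: "(\<lambda>k. k \<in> F) \<in> A" "w \<in> C F" by (auto simp: I_def)
    show "w \<in> A" by (rule determinedD[OF assms F(1)]) (use F(2) in \<open>simp add: C_def\<close>)
  qed
  then have "A = (\<Union>F\<in>I. C F)" by blast
  moreover have "finite I" by (simp add: I_def)
  moreover have "C F \<in> sets coin" for F unfolding C_def by (rule sets_coin_cylinder) simp
  ultimately show ?thesis by (simp add: sets.finite_UN)
qed

lemma sets_coin_determined: "sets coin = sigma_sets (space coin) {A. \<exists>n. determined n A}"
proof (rule antisym)
  have "sets coin = sigma_sets UNIV {{f. f i \<in> A} |i A. True}"
    unfolding coin_def sets_PiM_single by simp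
  also have "\<dots> \<subseteq> sigma_sets UNIV {A. \<exists>n. determined n A}"
  proof (rule sigma_sets_mono', clarify)
    fix i and A :: "bool set"
    have "determined (Suc i) {f. f i \<in> A}" by (auto simp: determined_def)
    then show "\<exists>n. determined n {f. f i \<in> A}" ..
  qed
  finally show "sets coin \<subseteq> sigma_sets (space coin) {A. \<exists>n. determined n A}" by simp
  show "sigma_sets (space coin) {A. \<exists>n. determined n A} \<subseteq> sets coin"
    by (rule sets.sigma_sets_subset) (auto intro: determined_sets)
qed

section \<open>Binary expansions with restricted digit positions\<close>

text \<open>With this sign, \<open>chr (l * x)\<close> is the exponential in
  \<open>spectral_measure\<close>.\<close>

definition chr :: "real \<Rightarrow> complex" where
  "chr x = cis (- 2 * pi * x)"

lemma chr_add: "chr (x + y) = chr x * chr y"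
  by (simp add: chr_def cis_mult algebra_simps)

lemma chr_0 [simp]: "chr 0 = 1"
  by (simp add: chr_def)

lemma cnj_chr: "cnj (chr x) = chr (- x)"
  by (simp add: chr_def cis_cnj)

lemma norm_chr [simp]: "cmod (chr x) = 1"
  by (simp add: chr_def)

lemma chr_Ints: "x \<in> \<int> \<Longrightarrow> chr x = 1"
  using cos_integer_2pi[of x] sin_integer_2pi[of x] by (simp add: chr_def complex_eq_iff)

lemma chr_half: "chr (1/2) = -1"
  by (simp add: chr_def complex_eq_iff)

lemma chr_sum: "chr (\<Sum>k\<in>H. f k) = (\<Prod>k\<in>H. chr (f k))"
  by (induction H rule: infinite_finite_induct) (auto simp: chr_add)

lemma chr_minus_one_le: "cmod (1 - chr x) \<le> 2 * pi * \<bar>x\<bar>"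
proof -
  have "cmod (iexp (- 2 * pi * x) - (\<Sum>k\<le>0. (\<i> * (- 2 * pi * x)) ^ k / fact k)) \<le> \<bar>- 2 * pi * x\<bar> ^ Suc 0 / fact (Suc 0)"
    by (rule iexp_approx1)
  then show ?thesis
    by (simp add: chr_def cis_conv_exp norm_minus_commute abs_mult)
qed

lemma chr_eq_exp: "chr (l * x) = exp (- 2 * of_real pi * \<i> * of_real l * of_real x)"
  by (simp add: chr_def cis_conv_exp mult_ac)

lemma continuous_chr: "continuous_on UNIV chr"
  unfolding chr_def by (intro continuous_intros)

lemma borel_measurable_chr [measurable]: "chr \<in> borel_measurable borel"
  by (rule borel_measurable_continuous_onI[OF continuous_chr])

text \<open>Common terms cancel, integers are invisible to \<open>chr\<close>, and a single term 1/2
  is left, whose sign does not matter modulo 1.\<close>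

lemma chr_sum_diff_half:
  assumes fin: "finite F" "finite G" and j: "j \<in> (F - G) \<union> (G - F)" and half: "w j = 1/2"
    and int: "\<And>k. k \<in> (F - G) \<union> (G - F) \<Longrightarrow> k \<noteq> j \<Longrightarrow> w k \<in> \<int>"
  shows "chr (sum w F - sum w G) = -1"
proof -
  have split: "sum w F - sum w G = sum w (F - G) - sum w (G - F)"
    using sum.Int_Diff[OF fin(1), of w G] sum.Int_Diff[OF fin(2), of w F] by (simp add: Int_commute)
  obtain z where z: "z \<in> \<int>" "sum w F - sum w G = 1/2 + z"
  proof (cases "j \<in> F - G")
    case True
    then have "sum w (F - G) = 1/2 + sum w (F - G - {j})"
      using fin half by (simp add: sum.remove)
    moreover have "sum w (F - G - {j}) \<in> \<int>" by (rule Ints_sum) (use int in auto)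
    moreover have "sum w (G - F) \<in> \<int>" by (rule Ints_sum) (use int True in blast)
    ultimately show ?thesis using split by (intro that[of "sum w (F - G - {j}) - sum w (G - F)"]) auto
  next
    case False
    then have "j \<in> G - F" using j by auto
    then have "sum w (G - F) = 1/2 + sum w (G - F - {j})"
      using fin half by (simp add: sum.remove)
    moreover have "sum w (G - F - {j}) \<in> \<int>" by (rule Ints_sum) (use int in auto)
    moreover have "sum w (F - G) \<in> \<int>" by (rule Ints_sum) (use int False j in blast)
    \<comment> \<open>The term 1/2 enters with a minus sign here; the \<open>- 1\<close> turns -1/2
      into 1/2.\<close>
    ultimately show ?thesis using split by (intro that[of "sum w (F - G) - sum w (G - F - {j}) - 1"]) auto
  qed
  show ?thesis unfolding z(2) chr_add by (simp add: chr_half chr_Ints[OF z(1)])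
qed

text \<open>Expanding the product yields one term per subset of \<open>A\<close>. A single
  \<open>k\<close> with \<open>chr (y * v k) = -1\<close> thus annihilates the whole sum.\<close>

lemma sum_Pow_chr:
  assumes "finite A"
  shows "(\<Sum>H\<in>Pow A. chr (y * (\<Sum>k\<in>H. v k))) = (\<Prod>k\<in>A. chr (y * v k) + 1)"
  by (subst prod_add[OF assms]) (simp add: sum_distrib_left chr_sum)

text \<open>\<open>b_0\<close> makes the truncated subtraction in \<open>b k - 1\<close> genuine and
  keeps all expansions in [0, 1].\<close>

locale digit_positions =
  fixes b :: "nat \<Rightarrow> nat"
  assumes strict_mono_b: "strict_mono b" and b_0: "0 < b 0"
begin

definition pos :: "nat set \<Rightarrow> real" where
  "pos F = (\<Sum>k\<in>F. (1/2) ^ b k)"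

text \<open>The exponent \<open>b k - 1\<close> rather than \<open>b k\<close> makes the product
  with the digit weight \<open>(1/2) ^ b k\<close> equal to 1/2, where \<open>chr\<close> is
  -1.\<close>

definition freq :: "nat set \<Rightarrow> real" where
  "freq F = (\<Sum>k\<in>F. 2 ^ (b k - 1))"

definition tail :: "nat \<Rightarrow> (nat \<Rightarrow> bool) \<Rightarrow> real" where
  "tail n w = (\<Sum>k. if w (k + n) then (1/2) ^ b (k + n) else 0)"

abbreviation point :: "(nat \<Rightarrow> bool) \<Rightarrow> real" where
  "point \<equiv> tail 0"

lemma b_pos: "0 < b k"
  using b_0 strict_mono_less_eq[OF strict_mono_b, of 0 k] by simp

lemma b_add: "b n + k \<le> b (k + n)"
proof (induction k)
  case (Suc k)
  then show ?case using strict_monoD[OF strict_mono_b, of "k + n" "Suc k + n"] by simp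
qed simp

lemma digit_le: "(if w (k + n) then (1/2) ^ b (k + n) else 0) \<le> (1/2) ^ b n * (1/2 :: real) ^ k"
proof -
  have "(1/2 :: real) ^ b (k + n) \<le> (1/2) ^ (b n + k)" by (intro power_decreasing b_add) auto
  then show ?thesis by (simp add: power_add)
qed

lemma summable_digits: "summable (\<lambda>k. if w (k + n) then (1/2 :: real) ^ b (k + n) else 0)"
proof (rule summable_comparison_test')
  show "summable (\<lambda>k. (1/2) ^ b n * (1/2 :: real) ^ k)" by (intro summable_mult summable_geometric) simp
  show "norm (if w (k + n) then (1/2 :: real) ^ b (k + n) else 0) \<le> (1/2) ^ b n * (1/2) ^ k" if "0 \<le> k" for k
    using digit_le[of w k n] by auto
qed

lemma tail_nonneg: "0 \<le> tail n w"
  unfolding tail_def by (intro suminf_nonneg summable_digits) auto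

lemma tail_le: "tail n w \<le> 2 * (1/2) ^ b n"
proof -
  have "tail n w \<le> (\<Sum>k. (1/2) ^ b n * (1/2) ^ k)"
    unfolding tail_def by (intro suminf_le digit_le summable_digits summable_mult summable_geometric) simp
  also have "\<dots> = 2 * (1/2) ^ b n" by (subst suminf_mult) (auto simp: suminf_geometric)
  finally show ?thesis .
qed

lemma tail_le_power: "m < b n \<Longrightarrow> tail n w \<le> (1/2) ^ m"
proof -
  assume "m < b n"
  then have "2 * (1/2 :: real) ^ b n \<le> 2 * (1/2) ^ Suc m" by (intro mult_left_mono power_decreasing) auto
  then show ?thesis using tail_le[of n w] by simp
qed

lemma point_le_1: "point w \<le> 1"
  using tail_le_power[of 0 0 w] b_0 by simp

lemma tail_cong: "(\<And>k. n \<le> k \<Longrightarrow> w k = w' k) \<Longrightarrow> tail n w = tail n w'"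
  unfolding tail_def by simp

lemma point_split: "point w = pos {k. k < n \<and> w k} + tail n w"
proof -
  have "point w = tail n w + (\<Sum>k<n. if w k then (1/2) ^ b k else 0)"
    using suminf_split_initial_segment[OF summable_digits[of w 0], of n] by (simp add: tail_def cong: if_cong)
  also have "(\<Sum>k<n. if w k then (1/2 :: real) ^ b k else 0) = pos {k. k < n \<and> w k}"
    using sum.inter_filter[of "{..<n}" "\<lambda>k. (1/2 :: real) ^ b k" w] by (simp add: pos_def)
  finally show ?thesis by simp
qed

lemma point_set_prefix:
  assumes "F \<subseteq> {..<n}"
  shows "point (set_prefix n F w) = pos F + tail n w"
proof -
  have "{k. k < n \<and> set_prefix n F w k} = F" using assms by (auto simp: set_prefix_def)
  moreover have "tail n (set_prefix n F w) = tail n w" by (rule tail_cong) (simp add: set_prefix_def)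
  ultimately show ?thesis by (simp add: point_split[of _ n])
qed

lemma borel_measurable_tail [measurable]: "tail n \<in> borel_measurable coin"
  unfolding tail_def by measurable

lemma freq_nonneg: "0 \<le> freq F"
  unfolding freq_def by (intro sum_nonneg) auto

text \<open>The exponents \<open>b k - 1\<close> for \<open>k \<le> n\<close> are distinct and less
  than \<open>b n\<close>, so a geometric sum bounds the powers.\<close>

lemma freq_le: "F \<subseteq> {..<Suc n} \<Longrightarrow> freq F \<le> 2 ^ b n"
proof -
  assume "F \<subseteq> {..<Suc n}"
  then have "freq F \<le> freq {..<Suc n}" unfolding freq_def by (intro sum_mono2) auto
  also have "freq {..<Suc n} \<le> 2 ^ b n"
  proof (induction n)
    case 0
    then show ?case by (simp add: freq_def)
  next
    case (Suc n)
    have "b n \<le> b (Suc n) - 1" using strict_monoD[OF strict_mono_b, of n "Suc n"] by simp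
    then have "(2::real) ^ b n \<le> 2 ^ (b (Suc n) - 1)" by (intro power_increasing) auto
    moreover have "freq {..<Suc (Suc n)} = freq {..<Suc n} + 2 ^ (b (Suc n) - 1)"
      unfolding freq_def by (subst sum.lessThan_Suc) simp
    ultimately have "freq {..<Suc (Suc n)} \<le> 2 * 2 ^ (b (Suc n) - 1)" using Suc by linarith
    also have "\<dots> = 2 ^ b (Suc n)" using b_pos[of "Suc n"] by (simp flip: power_Suc)
    finally show ?case .
  qed
  finally show ?thesis .
qed

lemma freq_Ints: "freq F \<in> \<int>"
  unfolding freq_def by (intro Ints_sum Ints_power) auto

section \<open>Orthogonality of exponentials on finite digit sums\<close>

lemma half_weight: "2 ^ (b j - 1) * (1/2 :: real) ^ b j = 1/2"
proof -
  obtain m where "b j = Suc m" using b_pos[of j] gr0_implies_Suc by blast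
  then show ?thesis by (simp add: power_divide)
qed

lemma Ints_weight: "j < k \<Longrightarrow> 2 ^ (b k - 1) * (1/2 :: real) ^ b j \<in> \<int>"
proof -
  assume "j < k"
  then have "b j \<le> b k - 1" using strict_monoD[OF strict_mono_b, of j k] by simp
  then obtain d where "b k - 1 = b j + d" using le_Suc_ex by blast
  then have "(2 :: real) ^ (b k - 1) * (1/2) ^ b j = 2 ^ d"
    by (simp add: power_divide power_add)
  then show ?thesis by simp
qed

text \<open>The least index at which \<open>F\<close> and \<open>G\<close> differ contributes 1/2 to
  the argument up to sign, larger ones contribute integers, and smaller ones cancel.\<close>

lemma chr_freq_diff:
  assumes "finite F" "finite G" "F \<noteq> G"
  shows "chr ((freq F - freq G) * (1/2) ^ b (Min ((F - G) \<union> (G - F)))) = -1"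
proof -
  define D where "D = (F - G) \<union> (G - F)"
  have D: "finite D" "D \<noteq> {}" using assms by (auto simp: D_def)
  define w where "w k = 2 ^ (b k - 1) * (1/2 :: real) ^ b (Min D)" for k
  have "chr (sum w F - sum w G) = -1"
  proof (rule chr_sum_diff_half[OF assms(1,2), of "Min D"])
    show "Min D \<in> (F - G) \<union> (G - F)" using Min_in[OF D] by (simp add: D_def)
    show "w (Min D) = 1/2" unfolding w_def by (rule half_weight)
    fix k assume "k \<in> (F - G) \<union> (G - F)" "k \<noteq> Min D"
    then have "Min D < k" using Min_le[OF D(1), of k] by (simp add: D_def)
    then show "w k \<in> \<int>" unfolding w_def by (rule Ints_weight)
  qed
  moreover have "sum w F - sum w G = (freq F - freq G) * (1/2) ^ b (Min D)"
    by (simp add: w_def freq_def sum_distrib_right left_diff_distrib)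
  ultimately show ?thesis by (simp add: D_def)
qed

text \<open>Dual to \<open>chr_freq_diff\<close>: a frequency weight is integral against digit
  weights of smaller index, so the greatest index of difference is tested.\<close>

lemma chr_pos_diff:
  assumes "finite F" "finite G" "F \<noteq> G"
  shows "chr ((pos F - pos G) * 2 ^ (b (Max ((F - G) \<union> (G - F))) - 1)) = -1"
proof -
  define D where "D = (F - G) \<union> (G - F)"
  have D: "finite D" "D \<noteq> {}" using assms by (auto simp: D_def)
  define w where "w k = 2 ^ (b (Max D) - 1) * (1/2 :: real) ^ b k" for k
  have "chr (sum w F - sum w G) = -1"
  proof (rule chr_sum_diff_half[OF assms(1,2), of "Max D"])
    show "Max D \<in> (F - G) \<union> (G - F)" using Max_in[OF D] by (simp add: D_def)
    show "w (Max D) = 1/2" unfolding w_def by (rule half_weight)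
    fix k assume "k \<in> (F - G) \<union> (G - F)" "k \<noteq> Max D"
    then have "k < Max D" using Max_ge[OF D(1), of k] by (simp add: D_def)
    then show "w k \<in> \<int>" unfolding w_def by (rule Ints_weight)
  qed
  moreover have "sum w F - sum w G = (pos F - pos G) * 2 ^ (b (Max D) - 1)"
    by (simp add: w_def pos_def sum_distrib_left right_diff_distrib mult.commute)
  ultimately show ?thesis by (simp add: D_def)
qed

text \<open>The rows of the matrix \<open>chr (freq F * pos H)\<close> are orthogonal: in the
  product of \<open>sum_Pow_chr\<close>, the factor at the least index of difference
  vanishes.\<close>

lemma sum_chr_pos:
  assumes "F \<subseteq> {..<n}" "G \<subseteq> {..<n}"
  shows "(\<Sum>H\<in>Pow {..<n}. chr ((freq F - freq G) * pos H)) = (if F = G then 2 ^ n else 0)"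
proof (cases "F = G")
  case True
  then show ?thesis by (simp add: card_Pow)
next
  case False
  have fin: "finite F" "finite G" using assms finite_subset by auto
  define j where "j = Min ((F - G) \<union> (G - F))"
  have "j \<in> (F - G) \<union> (G - F)" unfolding j_def using fin False by (intro Min_in) auto
  then have j: "j \<in> {..<n}" using assms by auto
  have "(\<Prod>k\<in>{..<n}. chr ((freq F - freq G) * (1/2) ^ b k) + 1) = 0"
    using chr_freq_diff[OF fin False] by (intro prod_zero bexI[OF _ j]) (simp_all add: j_def)
  then show ?thesis using False by (simp add: pos_def sum_Pow_chr)
qed

text \<open>Orthogonality of the columns of the same matrix, the form that inverts it in
  \<open>determined_approx\<close>.\<close>

lemma sum_chr_freq:
  assumes "F \<subseteq> {..<n}" "G \<subseteq> {..<n}"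
  shows "(\<Sum>H\<in>Pow {..<n}. chr (freq H * (pos F - pos G))) = (if F = G then 2 ^ n else 0)"
proof (cases "F = G")
  case True
  then show ?thesis by (simp add: card_Pow)
next
  case False
  have fin: "finite F" "finite G" using assms finite_subset by auto
  define j where "j = Max ((F - G) \<union> (G - F))"
  have "j \<in> (F - G) \<union> (G - F)" unfolding j_def using fin False by (intro Max_in) auto
  then have j: "j \<in> {..<n}" using assms by auto
  have "(\<Prod>k\<in>{..<n}. chr ((pos F - pos G) * 2 ^ (b k - 1)) + 1) = 0"
    using chr_pos_diff[OF fin False] by (intro prod_zero bexI[OF _ j]) (simp_all add: j_def)
  then show ?thesis using False by (simp add: freq_def sum_Pow_chr mult.commute[of "sum _ _"])
qed

text \<open>The matrix is \<open>sqrt (2 ^ n)\<close> times a unitary one: once the sum over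
  \<open>G\<close> is moved inside, only the diagonal survives.\<close>

lemma parseval_prefix:
  "(\<Sum>G\<in>Pow {..<n}. (cmod (\<Sum>F\<in>Pow {..<n}. c F * chr (freq F * pos G)))\<^sup>2) = 2 ^ n * (\<Sum>F\<in>Pow {..<n}. (cmod (c F))\<^sup>2)"
proof -
  let ?P = "Pow {..<n}"
  have e: "chr (freq F * pos G) * cnj (chr (freq F' * pos G)) = chr ((freq F - freq F') * pos G)" for F F' G
    by (simp add: cnj_chr chr_add[symmetric] left_diff_distrib)
  have "of_real (\<Sum>G\<in>?P. (cmod (\<Sum>F\<in>?P. c F * chr (freq F * pos G)))\<^sup>2) =
      (\<Sum>G\<in>?P. (\<Sum>F\<in>?P. c F * chr (freq F * pos G)) * cnj (\<Sum>F\<in>?P. c F * chr (freq F * pos G)))"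
    unfolding of_real_sum by (intro sum.cong) (simp_all only: complex_norm_square)
  also have "\<dots> = (\<Sum>G\<in>?P. \<Sum>F\<in>?P. \<Sum>F'\<in>?P. c F * cnj (c F') * chr ((freq F - freq F') * pos G))"
    unfolding e[symmetric] by (simp add: sum_product mult_ac)
  also have "\<dots> = (\<Sum>F\<in>?P. \<Sum>F'\<in>?P. \<Sum>G\<in>?P. c F * cnj (c F') * chr ((freq F - freq F') * pos G))"
    by (subst sum.swap) (intro sum.cong refl sum.swap)
  also have "\<dots> = (\<Sum>F\<in>?P. \<Sum>F'\<in>?P. c F * cnj (c F') * (if F = F' then 2 ^ n else 0))"
    by (intro sum.cong refl) (simp add: sum_chr_pos flip: sum_distrib_left)
  also have "\<dots> = (\<Sum>F\<in>?P. \<Sum>F'\<in>?P. if F' = F then c F * cnj (c F) * 2 ^ n else 0)"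
    by (intro sum.cong) auto
  also have "\<dots> = (\<Sum>F\<in>?P. c F * cnj (c F) * 2 ^ n)"
    by (intro sum.cong refl) (subst sum.delta, auto)
  also have "\<dots> = of_real (2 ^ n * (\<Sum>F\<in>?P. (cmod (c F))\<^sup>2))"
    by (simp add: complex_norm_square[symmetric] sum_distrib_left mult.commute)
  finally show ?thesis by (simp only: of_real_eq_iff)
qed

end

section \<open>Spectrality\<close>

lemma countable_finite_subsets_nat: "countable {F :: nat set. finite F}"
  using countable_Collect_finite_subset[of "UNIV :: nat set"] by simp

locale gapped_digit_positions = digit_positions +
  assumes gaps: "\<exists>n\<ge>m. b n + g \<le> b (Suc n)"
begin

text \<open>Sums run over frequency values rather than sets, to match
  \<open>L2_orthonormal_basis\<close>; \<open>trig_freq\<close> adds up the coefficients of sets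
  with equal frequency.\<close>

definition trig :: "((nat \<Rightarrow> bool) \<Rightarrow> complex) set" where
  "trig = {v. \<exists>S c. finite S \<and> S \<subseteq> freq ` {F. finite F} \<and> v = (\<lambda>w. \<Sum>l\<in>S. c l * chr (l * point w))}"

lemma trig_freq:
  assumes "finite \<F>" "\<And>F. F \<in> \<F> \<Longrightarrow> finite F"
  shows "(\<lambda>w. \<Sum>F\<in>\<F>. c F * chr (freq F * point w)) \<in> trig"
proof -
  define d where "d l = (\<Sum>F\<in>{F \<in> \<F>. freq F = l}. c F)" for l
  have "(\<Sum>F\<in>\<F>. c F * chr (freq F * point w)) = (\<Sum>l\<in>freq ` \<F>. d l * chr (l * point w))" for w
    using sum.image_gen[OF assms(1), of "\<lambda>F. c F * chr (freq F * point w)" freq]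
    by (simp add: d_def sum_distrib_right)
  then show ?thesis unfolding trig_def using assms by (intro CollectI exI[of _ "freq ` \<F>"] exI[of _ d]) auto
qed

lemma integrable_coin_bounded:
  fixes f :: "(nat \<Rightarrow> bool) \<Rightarrow> 'b::{banach, second_countable_topology}"
  shows "f \<in> borel_measurable coin \<Longrightarrow> (\<And>w. norm (f w) \<le> B) \<Longrightarrow> integrable coin f"
  by (rule coin.integrable_const_bound[of _ B]) auto

lemma norm_sum_chr_le: "cmod (\<Sum>l\<in>S. c l * chr (g l)) \<le> (\<Sum>l\<in>S. cmod (c l))"
  by (rule order_trans[OF norm_sum]) (simp add: norm_mult)

sublocale trig: L2_subspace coin trig
proof
  fix v assume "v \<in> trig"
  then obtain S c where v: "v = (\<lambda>w. \<Sum>l\<in>S. c l * chr (l * point w))" by (auto simp: trig_def)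
  have "cmod (v w) \<le> (\<Sum>l\<in>S. cmod (c l))" for w unfolding v by (rule norm_sum_chr_le)
  then have "norm ((cmod (v w))\<^sup>2) \<le> (\<Sum>l\<in>S. cmod (c l))\<^sup>2" for w
    using power_mono[of "cmod (v w)" _ 2] by simp
  moreover have [measurable]: "v \<in> borel_measurable coin" unfolding v by measurable
  ultimately have "integrable coin (\<lambda>w. (cmod (v w))\<^sup>2)" by (intro integrable_coin_bounded) auto
  then show "v \<in> L2_space coin" by (simp add: L2_space_def)
next
  show "(\<lambda>_. 0) \<in> trig" using trig_freq[of "{}"] by simp
next
  fix v w assume "v \<in> trig" "w \<in> trig"
  then obtain S c T d where S: "finite S" "S \<subseteq> freq ` {F. finite F}" "v = (\<lambda>w. \<Sum>l\<in>S. c l * chr (l * point w))"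
    and T: "finite T" "T \<subseteq> freq ` {F. finite F}" "w = (\<lambda>w. \<Sum>l\<in>T. d l * chr (l * point w))"
    unfolding trig_def by blast
  define e where "e l = (if l \<in> S then c l else 0) + (if l \<in> T then d l else 0)" for l
  have "(\<Sum>l\<in>S \<union> T. e l * chr (l * point x)) = v x + w x" for x
  proof -
    have "(\<Sum>l\<in>S \<union> T. e l * chr (l * point x)) =
        (\<Sum>l\<in>S \<union> T. if l \<in> S then c l * chr (l * point x) else 0) + (\<Sum>l\<in>S \<union> T. if l \<in> T then d l * chr (l * point x) else 0)"
      unfolding sum.distrib[symmetric] by (intro sum.cong refl) (simp add: e_def distrib_right)
    also have "\<dots> = v x + w x"
      using S T by (simp add: sum.inter_restrict[symmetric] Int_absorb1)
    finally show ?thesis .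
  qed
  then show "(\<lambda>x. v x + w x) \<in> trig"
    unfolding trig_def using S T by (intro CollectI exI[of _ "S \<union> T"] exI[of _ e]) auto
next
  fix v and a assume "v \<in> trig"
  then obtain S c where S: "finite S" "S \<subseteq> freq ` {F. finite F}" "v = (\<lambda>w. \<Sum>l\<in>S. c l * chr (l * point w))"
    unfolding trig_def by blast
  then show "(\<lambda>x. a * v x) \<in> trig"
    unfolding trig_def by (intro CollectI exI[of _ S] exI[of _ "\<lambda>l. a * c l"]) (auto simp: sum_distrib_left mult.assoc)
qed

text \<open>
  The \<open>2\<^sup>n\<close> frequencies \<open>freq F\<close>, \<open>F \<subseteq> {..<n}\<close>, form a unitary system on the \<open>2\<^sup>n\<close> prefixes of length
  \<open>n\<close>, so that the indicator of \<open>A\<close> is an exact combination of them at the truncated points; a long gap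
  behind the last prefix digit makes the contribution of the tail negligible in the \<open>L\<^sup>2\<close> sense.
\<close>

lemma determined_approx:
  assumes A: "determined (Suc n) A" and gap: "b n + g \<le> b (Suc n)"
  shows "\<exists>v\<in>trig. (LINT w|coin. (cmod (indicator A w - v w))\<^sup>2) \<le> (4 * pi * (1/2) ^ g)\<^sup>2"
proof -
  define N where "N = Suc n"
  let ?P = "Pow {..<N}"
  define ind where "ind H = (indicator A (\<lambda>k. k \<in> H) :: complex)" for H :: "nat set"
  \<comment> \<open>The inverse of the matrix \<open>chr (freq F * pos G)\<close>, that is its
    conjugate transpose divided by \<open>2 ^ N\<close>, applied to \<open>ind\<close>.\<close>
  define a where "a F = (\<Sum>H\<in>?P. ind H * chr (- freq F * pos H)) / 2 ^ N" for F
  define v where "v w = (\<Sum>F\<in>?P. a F * chr (freq F * point w))" for w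
  \<comment> \<open>\<open>2 * pi\<close> comes from \<open>chr_minus_one_le\<close>; the remaining
    \<open>2 * (1/2) ^ g\<close> bounds a frequency times a tail.\<close>
  define \<epsilon> :: real where "\<epsilon> = 4 * pi * (1/2) ^ g"
  have exact: "(\<Sum>F\<in>?P. a F * chr (freq F * pos G)) = ind G" if G: "G \<in> ?P" for G
  proof -
    have "(\<Sum>F\<in>?P. a F * chr (freq F * pos G)) =
        (\<Sum>F\<in>?P. \<Sum>H\<in>?P. ind H * chr (freq F * (pos G - pos H)) / 2 ^ N)"
    proof (intro sum.cong refl)
      fix F
      have "chr (freq F * (pos G - pos H)) = chr (- freq F * pos H) * chr (freq F * pos G)" for H
        by (simp add: algebra_simps flip: chr_add)
      then show "a F * chr (freq F * pos G) = (\<Sum>H\<in>?P. ind H * chr (freq F * (pos G - pos H)) / 2 ^ N)"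
        by (simp only: a_def sum_distrib_right sum_divide_distrib times_divide_eq_left mult.assoc)
    qed
    also have "\<dots> = (\<Sum>H\<in>?P. ind H / 2 ^ N * (\<Sum>F\<in>?P. chr (freq F * (pos G - pos H))))"
      by (subst sum.swap) (simp add: sum_distrib_left)
    also have "\<dots> = (\<Sum>H\<in>?P. ind H / 2 ^ N * (if G = H then 2 ^ N else 0))"
      using G by (intro sum.cong refl) (simp add: sum_chr_freq)
    also have "\<dots> = (\<Sum>H\<in>?P. if G = H then ind H else 0)" by (intro sum.cong) auto
    also have "\<dots> = ind G" using G by simp
    finally show ?thesis .
  qed
  have small: "(\<Sum>F\<in>?P. (cmod (a F))\<^sup>2) \<le> 1"
  proof -
    have "2 ^ N * (\<Sum>F\<in>?P. (cmod (a F))\<^sup>2) = (\<Sum>G\<in>?P. (cmod (ind G))\<^sup>2)"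
      unfolding parseval_prefix[symmetric] by (intro sum.cong refl) (simp only: exact)
    also have "\<dots> \<le> (\<Sum>G\<in>?P. 1)" by (intro sum_mono) (simp add: ind_def indicator_def)
    also have "\<dots> = 2 ^ N * 1" by (simp add: card_Pow)
    finally show ?thesis by (subst (asm) mult_le_cancel_left_pos) auto
  qed
  have vm [measurable]: "v \<in> borel_measurable coin" unfolding v_def by measurable
  have Am [measurable]: "A \<in> sets coin" by (rule determined_sets[OF A])
  define \<Psi> where "\<Psi> w = (cmod (indicator A w - v w))\<^sup>2" for w
  have \<Psi>m [measurable]: "\<Psi> \<in> borel_measurable coin" unfolding \<Psi>_def by measurable
  have \<Psi>b: "norm (\<Psi> w) \<le> (1 + (\<Sum>F\<in>?P. cmod (a F)))\<^sup>2" for w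
  proof -
    have "cmod (indicator A w - v w) \<le> 1 + (\<Sum>F\<in>?P. cmod (a F))"
      unfolding v_def
      by (rule order_trans[OF norm_triangle_ineq4]) (intro add_mono norm_sum_chr_le, simp add: indicator_def)
    then show ?thesis unfolding \<Psi>_def by (simp add: power_mono)
  qed
  have \<Psi>i: "integrable coin (\<lambda>w. \<Psi> (set_prefix N G w))" for G
    by (intro integrable_coin_bounded[OF _ \<Psi>b]) measurable
  \<comment> \<open>With the tail frozen, the sum over prefixes is again a Parseval sum, now with
    coefficients damped by \<open>1 - chr (freq F * t)\<close>. A termwise bound by absolute values
    could lose a factor growing with \<open>N\<close>.\<close>
  have avg: "(\<Sum>G\<in>?P. \<Psi> (set_prefix N G w)) \<le> 2 ^ N * \<epsilon>\<^sup>2" for w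
  proof -
    define t where "t = tail N w"
    define c where "c F = a F * (1 - chr (freq F * t))" for F
    have "\<Psi> (set_prefix N G w) = (cmod (\<Sum>F\<in>?P. c F * chr (freq F * pos G)))\<^sup>2" if G: "G \<in> ?P" for G
    proof -
      have "set_prefix N G w \<in> A \<longleftrightarrow> (\<lambda>k. k \<in> G) \<in> A"
      proof
        assume "set_prefix N G w \<in> A"
        then show "(\<lambda>k. k \<in> G) \<in> A" by (rule determinedD[OF A]) (simp add: set_prefix_def N_def)
      next
        assume "(\<lambda>k. k \<in> G) \<in> A"
        then show "set_prefix N G w \<in> A" by (rule determinedD[OF A]) (simp add: set_prefix_def N_def)
      qed
      then have "indicator A (set_prefix N G w) = (\<Sum>F\<in>?P. a F * chr (freq F * pos G))"
        unfolding exact[OF G] by (simp add: ind_def indicator_def)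
      moreover have "v (set_prefix N G w) = (\<Sum>F\<in>?P. a F * chr (freq F * pos G) * chr (freq F * t))"
        using G unfolding v_def by (simp add: point_set_prefix t_def distrib_left chr_add mult.assoc)
      ultimately have "indicator A (set_prefix N G w) - v (set_prefix N G w) = (\<Sum>F\<in>?P. c F * chr (freq F * pos G))"
        by (simp add: c_def algebra_simps flip: sum_subtractf)
      then show ?thesis by (simp add: \<Psi>_def)
    qed
    then have "(\<Sum>G\<in>?P. \<Psi> (set_prefix N G w)) = 2 ^ N * (\<Sum>F\<in>?P. (cmod (c F))\<^sup>2)"
      by (simp add: parseval_prefix)
    also have "\<dots> \<le> 2 ^ N * (\<Sum>F\<in>?P. \<epsilon>\<^sup>2 * (cmod (a F))\<^sup>2)"
    proof (intro mult_left_mono sum_mono)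
      fix F assume F: "F \<in> ?P"
      \<comment> \<open>The indices in \<open>F\<close> end at \<open>n\<close> and the tail starts
        at \<open>Suc n\<close>: the gap between these two positions makes the product
        small.\<close>
      have "freq F * t \<le> 2 ^ b n * (2 * (1/2) ^ b N)"
        using F freq_le[of F n] tail_le[of N w] tail_nonneg[of N w] by (intro mult_mono) (auto simp: N_def t_def)
      also have "\<dots> \<le> 2 ^ b n * (2 * (1/2) ^ (b n + g))"
        using gap by (intro mult_left_mono power_decreasing) (auto simp: N_def)
      also have "\<dots> = 2 * (1/2) ^ g" by (simp add: power_add power_divide)
      finally have "freq F * t \<le> 2 * (1/2) ^ g" .
      then have "2 * pi * (freq F * t) \<le> 2 * pi * (2 * (1/2) ^ g)" by (intro mult_left_mono) auto
      moreover have "0 \<le> freq F * t" by (simp add: freq_nonneg t_def tail_nonneg)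
      ultimately have "cmod (1 - chr (freq F * t)) \<le> \<epsilon>"
        using chr_minus_one_le[of "freq F * t"] unfolding \<epsilon>_def by linarith
      then have "(cmod (1 - chr (freq F * t)))\<^sup>2 \<le> \<epsilon>\<^sup>2" by (intro power_mono) auto
      then show "(cmod (c F))\<^sup>2 \<le> \<epsilon>\<^sup>2 * (cmod (a F))\<^sup>2"
        using mult_right_mono[of "(cmod (1 - chr (freq F * t)))\<^sup>2" "\<epsilon>\<^sup>2" "(cmod (a F))\<^sup>2"] by (simp add: c_def norm_mult power_mult_distrib mult.commute)
    qed auto
    also have "\<dots> \<le> 2 ^ N * (\<epsilon>\<^sup>2 * 1)"
      unfolding sum_distrib_left[symmetric] using small by (intro mult_left_mono) auto
    finally show ?thesis by simp
  qed
  have "(LINT w|coin. \<Psi> w) = (LINT w|coin. (\<Sum>G\<in>?P. \<Psi> (set_prefix N G w))) /\<^sub>R 2 ^ N"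
    using \<Psi>i by (simp add: integral_coin_prefix[OF \<Psi>m \<Psi>b, of N])
  also have "\<dots> \<le> (LINT w|coin. 2 ^ N * \<epsilon>\<^sup>2) /\<^sub>R 2 ^ N"
    using \<Psi>i avg by (intro scaleR_left_mono integral_mono) auto
  also have "\<dots> = \<epsilon>\<^sup>2" using coin.prob_space by simp
  finally have "(LINT w|coin. (cmod (indicator A w - v w))\<^sup>2) \<le> \<epsilon>\<^sup>2" unfolding \<Psi>_def .
  moreover have "v \<in> trig"
    unfolding v_def using finite_subset by (intro trig_freq) auto
  ultimately show ?thesis unfolding \<epsilon>_def by blast
qed

text \<open>A set determined by \<open>m\<close> coins is determined by any larger number of them,
  so a gap as late and as long as required is available.\<close>

lemma trig_dense:
  assumes "f \<in> L2_space coin"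
  shows "L2_approx coin trig f"
proof -
  have det: "L2_approx coin trig (indicator A)" if "determined m A" for m A
    unfolding L2_approx_def
  proof (intro conjI allI impI)
    show "indicator A \<in> L2_space coin" using trig.indicator_L2[OF determined_sets[OF that]] by simp
    fix e :: real assume "0 < e"
    have "(\<lambda>g. (4 * pi * (1/2) ^ g)\<^sup>2) \<longlonglongrightarrow> (4 * pi * 0)\<^sup>2"
      by (intro tendsto_intros LIMSEQ_power_zero) simp
    then have "\<forall>\<^sub>F g in sequentially. (4 * pi * (1/2) ^ g)\<^sup>2 < e"
      using \<open>0 < e\<close> by (intro order_tendstoD(2)) auto
    then obtain g :: nat where g: "(4 * pi * (1/2) ^ g)\<^sup>2 < e" by (auto simp: eventually_sequentially)
    obtain n where n: "n \<ge> m" "b n + g \<le> b (Suc n)" using gaps by blast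
    have "determined (Suc n) A" using that n(1) by (rule determined_mono[OF _ le_SucI])
    from determined_approx[OF this n(2)] g
    show "\<exists>v\<in>trig. (LINT w|coin. (cmod (indicator A w - v w))\<^sup>2) < e" by force
  qed
  have "determined 0 UNIV" by (simp add: determined_def)
  from det[OF this] have "L2_approx coin trig (\<lambda>_. 1)" by (simp add: indicator_def)
  then show ?thesis
    by (intro trig.dense_if_generator_approx[OF Int_stable_determined _ sets_coin_determined _ _ assms])
      (auto intro: det determined_sets)
qed

text \<open>Conditioning on a prefix that contains \<open>F\<close> and \<open>G\<close> splits off
  the tail as a common factor, and the prefix sum is exactly zero; no limit is involved.\<close>

lemma integral_chr_freq:
  assumes "finite F" "finite G" "F \<noteq> G"
  shows "(LINT w|coin. chr ((freq F - freq G) * point w)) = 0"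
proof -
  obtain n where n: "F \<union> G \<subseteq> {..<n}"
    using finite_nat_bounded[of "F \<union> G"] assms by auto
  let ?f = "\<lambda>w. chr ((freq F - freq G) * point w)"
  have "(LINT w|coin. ?f w) = (\<Sum>H\<in>Pow {..<n}. LINT w|coin. ?f (set_prefix n H w)) /\<^sub>R 2 ^ n"
    by (rule integral_coin_prefix[of _ 1]) auto
  also have "(\<Sum>H\<in>Pow {..<n}. LINT w|coin. ?f (set_prefix n H w)) =
      (\<Sum>H\<in>Pow {..<n}. chr ((freq F - freq G) * pos H) * (LINT w|coin. chr ((freq F - freq G) * tail n w)))"
    by (intro sum.cong refl) (simp add: point_set_prefix distrib_left chr_add)
  also have "\<dots> = 0"
    using n assms(3) by (simp add: sum_chr_pos flip: sum_distrib_right)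
  finally show ?thesis by simp
qed

lemma chr_shift:
  assumes "l \<in> freq ` {F. finite F}" "x - y \<in> \<int>"
  shows "chr (l * x) = chr (l * y)"
proof -
  have "l * (x - y) \<in> \<int>" using assms freq_Ints by (intro Ints_mult) auto
  then show ?thesis using chr_add[of "l * y" "l * (x - y)"] by (simp add: chr_Ints algebra_simps)
qed

text \<open>Exponentials with integer frequencies agree at \<open>\<Phi> w\<close> and
  \<open>point w\<close>, so orthogonality and density are obtained on coin sequences and
  transported by the image measure.\<close>

lemma spectral_measure_shifted:
  assumes \<Phi> [measurable]: "\<Phi> \<in> borel_measurable coin" and shift: "\<And>w. \<Phi> w - point w \<in> \<int>"
  shows "spectral_measure (distr coin borel \<Phi>)"
proof -
  define \<nu> where "\<nu> = distr coin borel \<Phi>"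
  define \<Lambda> where "\<Lambda> = freq ` {F. finite F}"
  interpret \<nu>: real_distribution \<nu> unfolding \<nu>_def by (rule coin.real_distribution_distr) simp
  have chr\<Phi>: "chr (l * \<Phi> w) = chr (l * point w)" if "l \<in> \<Lambda>" for l w
    using chr_shift[OF _ shift] that by (simp add: \<Lambda>_def)
  have "L2_orthonormal_basis \<nu> (\<lambda>l x. chr (l * x)) \<Lambda>"
    unfolding L2_orthonormal_basis_def
  proof (intro conjI ballI allI impI)
    fix l assume "l \<in> \<Lambda>"
    then show "(\<lambda>x. chr (l * x)) \<in> L2_space \<nu>"
      by (auto simp: L2_space_def)
  next
    fix l l' assume ll: "l \<in> \<Lambda>" "l' \<in> \<Lambda>"
    have "L2_inner \<nu> (\<lambda>x. chr (l * x)) (\<lambda>x. chr (l' * x)) = (LINT w|coin. chr (l * \<Phi> w) * chr (- (l' * \<Phi> w)))"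
      unfolding L2_inner_def \<nu>_def cnj_chr by (rule integral_distr) measurable
    also have "\<dots> = (LINT w|coin. chr ((l - l') * point w))"
    proof (rule Bochner_Integration.integral_cong[OF refl])
      fix w
      have "chr (l * \<Phi> w) * chr (- (l' * \<Phi> w)) = chr (l * point w) * chr (- (l' * point w))"
        unfolding cnj_chr[symmetric] chr\<Phi>[OF ll(1)] chr\<Phi>[OF ll(2)] ..
      then show "chr (l * \<Phi> w) * chr (- (l' * \<Phi> w)) = chr ((l - l') * point w)"
        by (simp add: left_diff_distrib flip: chr_add)
    qed
    also have "\<dots> = (if l = l' then 1 else 0)"
    proof (cases "l = l'")
      case True
      then show ?thesis using coin.prob_space by simp
    next
      case False
      then show ?thesis using ll integral_chr_freq by (auto simp: \<Lambda>_def)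
    qed
    finally show "L2_inner \<nu> (\<lambda>x. chr (l * x)) (\<lambda>x. chr (l' * x)) = (if l = l' then 1 else 0)" .
  next
    fix f and \<epsilon> :: real assume f: "f \<in> L2_space \<nu>" and "0 < \<epsilon>"
    then have fm [measurable]: "f \<in> borel_measurable borel" by (auto simp: L2_space_def \<nu>_def)
    have "(\<lambda>w. f (\<Phi> w)) \<in> L2_space coin"
      using f by (auto simp: L2_space_def \<nu>_def integrable_distr_eq)
    then have "L2_approx coin trig (\<lambda>w. f (\<Phi> w))" by (rule trig_dense)
    then obtain v where v: "v \<in> trig" "(LINT w|coin. (cmod (f (\<Phi> w) - v w))\<^sup>2) < \<epsilon>\<^sup>2"
      using \<open>0 < \<epsilon>\<close> unfolding L2_approx_def by (meson zero_less_power)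
    then obtain S c where S: "finite S" "S \<subseteq> \<Lambda>" "v = (\<lambda>w. \<Sum>l\<in>S. c l * chr (l * point w))"
      unfolding trig_def \<Lambda>_def by blast
    have v': "v w = (\<Sum>l\<in>S. c l * chr (l * \<Phi> w))" for w
      unfolding S(3) using S(2) chr\<Phi> by (intro sum.cong) auto
    have "L2_norm \<nu> (\<lambda>x. f x - (\<Sum>l\<in>S. c l * chr (l * x))) = sqrt (LINT w|coin. (cmod (f (\<Phi> w) - v w))\<^sup>2)"
      unfolding L2_norm_def \<nu>_def v' by (subst integral_distr) auto
    also have "\<dots> < \<epsilon>" using v(2) \<open>0 < \<epsilon>\<close> by (intro real_less_lsqrt) auto
    finally show "\<exists>F c. finite F \<and> F \<subseteq> \<Lambda> \<and> L2_norm \<nu> (\<lambda>x. f x - (\<Sum>l\<in>F. c l * chr (l * x))) < \<epsilon>"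
      using S(1,2) by blast
  qed
  moreover have "countable \<Lambda>" unfolding \<Lambda>_def by (intro countable_image countable_finite_subsets_nat)
  ultimately show ?thesis
    unfolding spectral_measure_def chr_eq_exp \<nu>_def[symmetric] using \<nu>.real_distribution_axioms by blast
qed

end

section \<open>Support of the shifted Cantor measure\<close>

lemma closed_spt: "closed (spt M)"
  unfolding spt_def Compl_eq_Diff_UNIV[symmetric] by (intro closed_Compl open_Union) auto

text \<open>The union that forms the complement may be uncountable; Lindelof reduces it to countably
  many null sets.\<close>

lemma emeasure_Compl_spt:
  fixes M :: "'a::second_countable_topology measure"
  assumes "sets M = sets borel"
  shows "emeasure M (- spt M) = 0"
proof -
  define \<U> where "\<U> = {U. open U \<and> emeasure M U = 0}"
  obtain \<V> where \<V>: "\<V> \<subseteq> \<U>" "countable \<V>" "\<Union>\<V> = \<Union>\<U>"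
    using Lindelof[of \<U>] by (auto simp: \<U>_def)
  have "(\<Union>U\<in>\<V>. U) \<in> null_sets M"
    using \<V>(1,2) assms by (intro null_sets_UN') (auto simp: \<U>_def null_sets_def)
  then have "emeasure M (\<Union>\<U>) = 0" using \<V>(3) by (simp add: null_setsD1)
  then show ?thesis by (simp add: spt_def \<U>_def double_diff Compl_eq_Diff_UNIV)
qed

lemma in_spt_iff: "x \<in> spt M \<longleftrightarrow> (\<forall>U. open U \<longrightarrow> x \<in> U \<longrightarrow> emeasure M U \<noteq> 0)"
  by (auto simp: spt_def)

text \<open>\<open>Suc n\<close> is the least exponent whose power falls below
  \<open>r\<close>.\<close>

lemma dyadic_scale:
  fixes r :: real
  assumes "0 < r" "r \<le> (1/2) ^ m"
  obtains n where "m \<le> n" "(1/2) ^ Suc n < r" "r \<le> (1/2) ^ n"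
proof -
  have "\<exists>n. (1/2) ^ n < r" using assms(1) real_arch_pow_inv[of r "1/2"] by auto
  define N where "N = (LEAST n. (1/2) ^ n < r)"
  have N: "(1/2) ^ N < r" unfolding N_def by (rule LeastI_ex) fact
  have "m < N"
  proof (rule ccontr)
    assume "\<not> m < N"
    then have "(1/2 :: real) ^ m \<le> (1/2) ^ N" by (intro power_decreasing) auto
    with N assms(2) show False by simp
  qed
  then obtain n where n: "N = Suc n" "m \<le> n" by (metis less_Suc_eq_le not0_implies_Suc not_less0)
  have "\<not> (1/2) ^ n < r" using not_less_Least[of n "\<lambda>n. (1/2) ^ n < r"] n(1) by (simp add: N_def)
  with N n show ?thesis by (intro that[of n]) auto
qed

lemma half_powr_nat: "((1/2 :: real) ^ n) powr s = 2 powr (- (s * n))"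
  by (simp add: powr_realpow[symmetric] powr_powr powr_minus_divide powr_divide mult.commute)

lemma half_power_eq_powr: "(1/2 :: real) ^ n = 2 powr (- real n)"
  using half_powr_nat[of n 1] by simp

lemma sets_coin_vimage: "f \<in> measurable coin M \<Longrightarrow> B \<in> sets M \<Longrightarrow> {w. f w \<in> B} \<in> sets coin"
  using measurable_sets[of f coin M B] by (simp add: vimage_def)

text \<open>\<open>count\<close> makes \<open>c n\<close> the number of positions up to
  \<open>n\<close>; in particular \<open>n < b (c n)\<close>, so coins from index \<open>c n\<close>
  on act beyond \<open>n\<close>.\<close>

locale cantor_expansion = gapped_digit_positions +
  fixes c :: "nat \<Rightarrow> nat"
  assumes count: "b k \<le> n \<longleftrightarrow> k < c n"
begin

text \<open>On the all-\<open>False\<close> sequence this is some natural number, so the shift is an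
  integer there as well.\<close>

definition first :: "(nat \<Rightarrow> bool) \<Rightarrow> nat" where
  "first w = (LEAST k. w k)"

definition \<Phi> :: "(nat \<Rightarrow> bool) \<Rightarrow> real" where
  "\<Phi> w = point w + 2 * real (first w)"

definition \<nu> :: "real measure" where
  "\<nu> = distr coin borel \<Phi>"

text \<open>The whole translate, not only the sequences with \<open>first w = k\<close>: this is
  enough for upper bounds and admits every prefix.\<close>

definition piece :: "nat \<Rightarrow> real set" where
  "piece k = closure (range (\<lambda>w. point w + 2 * real k))"

lemma measurable_first [measurable]: "first \<in> measurable coin (count_space UNIV)"
  unfolding first_def by measurable

lemma measurable_\<Phi> [measurable]: "\<Phi> \<in> borel_measurable coin"
  unfolding \<Phi>_def by measurable

lemma sets_\<nu> [simp, measurable_cong]: "sets \<nu> = sets borel"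
  by (simp add: \<nu>_def)

lemma emeasure_\<nu>: "A \<in> sets borel \<Longrightarrow> emeasure \<nu> A = emeasure coin {w. \<Phi> w \<in> A}"
  unfolding \<nu>_def by (subst emeasure_distr) (auto simp: vimage_def)

lemma first_eq:
  assumes "\<bar>\<Phi> w - \<Phi> w'\<bar> < 1"
  shows "first w = first w'"
proof -
  have "\<bar>point w - point w'\<bar> \<le> 1"
    using point_le_1[of w] point_le_1[of w'] tail_nonneg[of 0 w] tail_nonneg[of 0 w'] by linarith
  then have "\<bar>real (first w) - real (first w')\<bar> < 1" using assms unfolding \<Phi>_def by linarith
  then show ?thesis by linarith
qed

lemma cell:
  "pos {k. k < c n \<and> w k} \<le> point w" "point w \<le> pos {k. k < c n \<and> w k} + (1/2) ^ n"
proof -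
  have "n < b (c n)" using count[of "c n" n] by simp
  then show "pos {k. k < c n \<and> w k} \<le> point w" "point w \<le> pos {k. k < c n \<and> w k} + (1/2) ^ n"
    using tail_le_power[of n "c n" w] tail_nonneg[of "c n" w] by (auto simp: point_split[of w "c n"])
qed

text \<open>An interval of length at most \<open>(1/2) ^ n\<close> can be reached from at most three
  dyadic cells of that length, and a charged cell corresponds to one prefix of \<open>c n\<close>
  coins.\<close>

lemma emeasure_cell_le:
  fixes y :: real
  assumes r: "2 * r \<le> (1/2) ^ n"
  shows "emeasure coin {w. \<bar>point w - y\<bar> \<le> r} \<le> ennreal (3 * (1/2) ^ c n)"
proof -
  define P where "P w = {k. k < c n \<and> w k}" for w :: "nat \<Rightarrow> bool"
  \<comment> \<open>The integer \<open>2 ^ n * pos (P w)\<close> expressed by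
    \<open>set_encode\<close>, whose injectivity shows that it identifies the prefix.\<close>
  define code where "code w = int (set_encode ((\<lambda>k. n - b k) ` P w))" for w
  have inj: "inj_on (\<lambda>k. n - b k) {..<c n}"
  proof (rule inj_onI)
    fix x y assume "x \<in> {..<c n}" "y \<in> {..<c n}" "n - b x = n - b y"
    then have "b x = b y" using count[of x n] count[of y n] by simp
    then show "x = y" using strict_mono_eq[OF strict_mono_b] by simp
  qed
  have P_sub: "P w \<subseteq> {..<c n}" for w by (auto simp: P_def)
  have P_fin: "finite (P w)" for w using finite_subset[OF P_sub] by simp
  have code_inj: "P w = P w'" if "code w = code w'" for w w'
  proof -
    have "(\<lambda>k. n - b k) ` P w = (\<lambda>k. n - b k) ` P w'"
      using that set_encode_eq P_fin by (simp add: code_def)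
    then show ?thesis using inj_on_image_eq_iff[OF inj P_sub P_sub] by simp
  qed
  have code_eq: "real_of_int (code w) = 2 ^ n * pos (P w)" for w
  proof -
    have "code w = int (\<Sum>k\<in>P w. 2 ^ (n - b k))"
      unfolding code_def set_encode_def using inj_on_subset[OF inj P_sub]
      by (subst sum.reindex) (simp_all add: o_def)
    then have "real_of_int (code w) = (\<Sum>k\<in>P w. 2 ^ (n - b k))" by simp
    also have "\<dots> = (\<Sum>k\<in>P w. 2 ^ n * (1/2) ^ b k)"
    proof (rule sum.cong[OF refl])
      fix k assume "k \<in> P w"
      then have "b k \<le> n" using count by (simp add: P_def)
      then show "(2 :: real) ^ (n - b k) = 2 ^ n * (1/2) ^ b k" by (simp add: power_diff power_divide)
    qed
    finally show ?thesis by (simp add: pos_def sum_distrib_left)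
  qed
  have fiber: "emeasure coin {w. code w = v} \<le> ennreal ((1/2) ^ c n)" for v
  proof (cases "\<exists>w0. code w0 = v")
    case True
    then obtain w0 where w0: "code w0 = v" by blast
    have "{w. code w = v} \<subseteq> {w. \<forall>k<c n. w k = (k \<in> P w0)}"
    proof (intro subsetI CollectI allI impI)
      fix w k assume "w \<in> {w. code w = v}" "k < c n"
      then have "P w = P w0" using code_inj w0 by simp
      then show "w k = (k \<in> P w0)" using \<open>k < c n\<close> by (auto simp: P_def)
    qed
    then have "emeasure coin {w. code w = v} \<le> emeasure coin {w. \<forall>k<c n. w k = (k \<in> P w0)}"
      using sets_coin_cylinder[of "{..<c n}" "\<lambda>k. {k \<in> P w0}"] by (intro emeasure_mono) (auto simp: Ball_def)
    then show ?thesis by (simp only: emeasure_coin_cylinder)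
  qed simp
  have code_sets: "{w. code w = v} \<in> sets coin" for v
  proof (rule determined_sets[of "c n"], unfold determined_def, intro allI impI)
    fix w w' :: "nat \<Rightarrow> bool" assume "\<forall>k<c n. w k = w' k" "w \<in> {w. code w = v}"
    moreover from this have "P w = P w'" by (auto simp: P_def)
    ultimately show "w' \<in> {w. code w = v}" by (simp add: code_def)
  qed
  \<comment> \<open>In units of \<open>(1/2) ^ n\<close>, the cell from \<open>code w\<close> to
    \<open>code w + 1\<close> meets an interval of length at most 1, so \<open>code w\<close> lies
    in an interval of length at most 2 that starts at \<open>2 ^ n * (y - r) - 1\<close>.\<close>
  define m where "m = \<lceil>2 ^ n * (y - r) - 1\<rceil>"
  have sub: "{w. \<bar>point w - y\<bar> \<le> r} \<subseteq> (\<Union>v\<in>{m, m + 1, m + 2}. {w. code w = v})"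
  proof
    fix w assume "w \<in> {w. \<bar>point w - y\<bar> \<le> r}"
    then have w: "y - r \<le> point w" "point w \<le> y + r" by auto
    have "2 ^ n * (y - r) \<le> 2 ^ n * (pos (P w) + (1/2) ^ n)"
      using w(1) cell(2)[of w n] by (intro mult_left_mono) (auto simp: P_def)
    also have "\<dots> = real_of_int (code w) + 1" by (simp add: code_eq distrib_left power_divide)
    finally have "m \<le> code w" unfolding m_def by (intro ceiling_le) simp
    have "real_of_int (code w) \<le> 2 ^ n * (y + r)"
      unfolding code_eq using w(2) cell(1)[of n w] by (intro mult_left_mono) (auto simp: P_def)
    also have "\<dots> = 2 ^ n * (y - r) + 2 ^ n * (2 * r)" by (simp add: algebra_simps)
    also have "\<dots> \<le> 2 ^ n * (y - r) + 2 ^ n * (1/2) ^ n" using r by (intro add_left_mono mult_left_mono) auto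
    also have "\<dots> = 2 ^ n * (y - r) - 1 + 2" by (simp add: power_divide)
    also have "\<dots> \<le> real_of_int m + 2" unfolding m_def by (intro add_right_mono le_of_int_ceiling)
    finally have "code w \<le> m + 2" by linarith
    with \<open>m \<le> code w\<close> have "code w \<in> {m, m + 1, m + 2}" by auto
    then show "w \<in> (\<Union>v\<in>{m, m + 1, m + 2}. {w. code w = v})" by blast
  qed
  have "emeasure coin {w. \<bar>point w - y\<bar> \<le> r} \<le> emeasure coin (\<Union>v\<in>{m, m + 1, m + 2}. {w. code w = v})"
    using code_sets by (intro emeasure_mono sub sets.finite_UN) auto
  also have "\<dots> \<le> (\<Sum>v\<in>{m, m + 1, m + 2}. emeasure coin {w. code w = v})"
    using code_sets by (intro emeasure_subadditive_finite) auto
  also have "\<dots> \<le> (\<Sum>v\<in>{m, m + 1, m + 2}. ennreal ((1/2) ^ c n))" by (intro sum_mono fiber)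
  also have "\<dots> = ennreal (\<Sum>v\<in>{m, m + 1, m + 2}. (1/2) ^ c n)" by (intro sum_ennreal) simp
  also have "\<dots> = ennreal (3 * (1/2) ^ c n)" by simp
  finally show ?thesis .
qed

text \<open>\<open>1 \<le> n\<close> gives \<open>2 * r < 1\<close>, so all sequences landing in the
  ball share the same \<open>first\<close> and the shift is constant there.\<close>

lemma emeasure_\<nu>_cball_le:
  assumes r: "2 * r \<le> (1/2) ^ n" and "1 \<le> n"
  shows "emeasure \<nu> (cball x r) \<le> ennreal (3 * (1/2) ^ c n)"
proof (cases "\<exists>w0. \<Phi> w0 \<in> cball x r")
  case True
  then obtain w0 where w0: "\<Phi> w0 \<in> cball x r" by blast
  have "(1/2 :: real) ^ n \<le> (1/2) ^ 1" using \<open>1 \<le> n\<close> by (intro power_decreasing) auto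
  with r have "2 * r < 1" by simp
  have "{w. \<Phi> w \<in> cball x r} \<subseteq> {w. \<bar>point w - (x - 2 * real (first w0))\<bar> \<le> r}"
  proof (intro subsetI CollectI)
    fix w assume "w \<in> {w. \<Phi> w \<in> cball x r}"
    then have w: "\<bar>\<Phi> w - x\<bar> \<le> r" by (simp add: dist_real_def abs_minus_commute)
    moreover have "\<bar>\<Phi> w0 - x\<bar> \<le> r" using w0 by (simp add: dist_real_def abs_minus_commute)
    ultimately have "first w = first w0" using \<open>2 * r < 1\<close> by (intro first_eq) linarith
    with w show "\<bar>point w - (x - 2 * real (first w0))\<bar> \<le> r" by (simp add: \<Phi>_def algebra_simps)
  qed
  moreover have "{w \<in> space coin. \<bar>point w - (x - 2 * real (first w0))\<bar> \<le> r} \<in> sets coin" by measurable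
  ultimately have "emeasure \<nu> (cball x r) \<le> emeasure coin {w. \<bar>point w - (x - 2 * real (first w0))\<bar> \<le> r}"
    by (subst emeasure_\<nu>) (auto intro!: emeasure_mono)
  also have "\<dots> \<le> ennreal (3 * (1/2) ^ c n)" by (rule emeasure_cell_le[OF r])
  finally show ?thesis .
next
  case False
  then have "{w. \<Phi> w \<in> cball x r} = {}" by blast
  then show ?thesis by (simp add: emeasure_\<nu>)
qed

text \<open>Values of \<open>\<Phi>\<close> within 1/2 of a point of the support have a common
  \<open>first\<close>, hence they accumulate at it within a single translate.\<close>

lemma spt_subset_pieces: "spt \<nu> \<subseteq> (\<Union>k. piece k)"
proof
  fix x assume x: "x \<in> spt \<nu>"
  have hit: "\<exists>w. \<Phi> w \<in> ball x e" if "0 < e" for e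
  proof (rule ccontr)
    assume "\<not> ?thesis"
    then have "{w. \<Phi> w \<in> ball x e} = {}" by blast
    then have "emeasure \<nu> (ball x e) = 0" by (simp add: emeasure_\<nu>)
    with x \<open>0 < e\<close> show False by (auto simp: in_spt_iff)
  qed
  obtain w0 where w0: "\<Phi> w0 \<in> ball x (1/2)" using hit[of "1/2"] by auto
  have "x \<in> piece (first w0)"
    unfolding piece_def closure_approachable
  proof (intro allI impI)
    fix e :: real assume "0 < e"
    then obtain w where w: "\<Phi> w \<in> ball x (min e (1/2))" using hit[of "min e (1/2)"] by auto
    then have "\<bar>\<Phi> w - x\<bar> < 1/2" "\<bar>\<Phi> w0 - x\<bar> < 1/2" using w0 by (auto simp: dist_real_def abs_minus_commute)
    then have "first w = first w0" by (intro first_eq) linarith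
    then have "point w + 2 * real (first w0) = \<Phi> w" by (simp add: \<Phi>_def)
    then show "\<exists>y\<in>range (\<lambda>w. point w + 2 * real (first w0)). dist y x < e"
      using w by (intro bexI[of _ "\<Phi> w"]) (auto simp: dist_commute intro: rev_image_eqI[of w])
  qed
  then show "x \<in> (\<Union>k. piece k)" by blast
qed

lemma piece_cover: "piece k \<subseteq> (\<Union>F\<in>Pow {..<c n}. {pos F + 2 * real k .. pos F + 2 * real k + (1/2) ^ n})"
  unfolding piece_def
proof (rule closure_minimal)
  show "range (\<lambda>w. point w + 2 * real k) \<subseteq> (\<Union>F\<in>Pow {..<c n}. {pos F + 2 * real k .. pos F + 2 * real k + (1/2) ^ n})"
  proof (rule image_subsetI)
    fix w
    have "{k. k < c n \<and> w k} \<in> Pow {..<c n}" by auto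
    then show "point w + 2 * real k \<in> (\<Union>F\<in>Pow {..<c n}. {pos F + 2 * real k .. pos F + 2 * real k + (1/2) ^ n})"
      using cell(1)[of n w] cell(2)[of w n] by (intro UN_I) auto
  qed
  show "closed (\<Union>F\<in>Pow {..<c n}. {pos F + 2 * real k .. pos F + 2 * real k + (1/2) ^ n})"
    by (intro closed_UN) auto
qed

section \<open>Mass, non-compactness and singularity of the support\<close>

lemma emeasure_\<nu>_spt: "emeasure \<nu> (spt \<nu>) = 1"
proof -
  have "emeasure \<nu> (UNIV - spt \<nu>) = 0" using emeasure_Compl_spt[of \<nu>] by (simp add: Compl_eq_Diff_UNIV)
  moreover have "emeasure \<nu> UNIV = 1" using coin.emeasure_space_1 by (simp add: emeasure_\<nu>)
  moreover have "spt \<nu> \<in> sets \<nu>" using borel_closed[OF closed_spt[of \<nu>]] by simp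
  ultimately show ?thesis
    using emeasure_Un_null_set[of "spt \<nu>" \<nu> "UNIV - spt \<nu>"] by (simp add: null_sets_def)
qed

text \<open>The first \<open>True\<close> coin has index \<open>k\<close> with probability
  \<open>(1/2) ^ (k + 1)\<close>, and then \<open>\<Phi>\<close> is at least \<open>k\<close>; so
  arbitrarily large values have positive mass, while the complement of the support is null.\<close>

lemma not_compact_spt: "\<not> compact (spt \<nu>)"
proof
  assume "compact (spt \<nu>)"
  then obtain R where R: "\<And>x. x \<in> spt \<nu> \<Longrightarrow> \<bar>x\<bar> \<le> R"
    using compact_imp_bounded bounded_iff by (metis real_norm_def)
  obtain k :: nat where k: "R < real k" using reals_Archimedean2 by blast
  have "{w. \<forall>j<Suc k. w j = (j \<in> {k})} \<subseteq> {w. \<Phi> w \<in> - spt \<nu>}"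
  proof (intro subsetI CollectI ComplI)
    fix w assume w: "w \<in> {w. \<forall>j<Suc k. w j = (j \<in> {k})}" and "\<Phi> w \<in> spt \<nu>"
    have "first w = k" unfolding first_def by (rule Least_equality) (use w in \<open>auto intro!: leI\<close>)
    then have "real k \<le> \<Phi> w" using tail_nonneg[of 0 w] by (simp add: \<Phi>_def)
    then show False using R[OF \<open>\<Phi> w \<in> spt \<nu>\<close>] k by simp
  qed
  moreover have B: "- spt \<nu> \<in> sets borel" using borel_closed[OF closed_spt[of \<nu>]] by simp
  moreover have "{w. \<Phi> w \<in> - spt \<nu>} \<in> sets coin" by (rule sets_coin_vimage[OF measurable_\<Phi> B])
  ultimately have "emeasure coin {w. \<forall>j<Suc k. w j = (j \<in> {k})} \<le> emeasure \<nu> (- spt \<nu>)"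
    unfolding emeasure_\<nu>[OF B] by (intro emeasure_mono)
  then have "ennreal ((1/2) ^ Suc k) \<le> 0"
    unfolding emeasure_coin_cylinder emeasure_Compl_spt[OF sets_\<nu>] .
  then show False by (simp add: ennreal_eq_0_iff flip: not_less)
qed

lemma spectral_measure_\<nu>: "spectral_measure \<nu>"
  unfolding \<nu>_def by (rule spectral_measure_shifted) (auto simp: \<Phi>_def)

lemma sparse: "\<exists>n. c n + g \<le> n"
proof -
  \<comment> \<open>Of the 2 extra places, one pays for \<open>c n\<close> being up to
    \<open>Suc j\<close>, the other for \<open>n\<close> stopping just before
    \<open>b (Suc j)\<close>.\<close>
  obtain j where j: "b j + (g + 2) \<le> b (Suc j)" using gaps[of 0 "g + 2"] by blast
  define n where "n = b (Suc j) - 1"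
  have "c n \<le> Suc j" using count[of "Suc j" n] b_pos[of "Suc j"] by (auto simp: n_def not_less)
  moreover have "j \<le> b j" using strict_mono_imp_increasing[OF strict_mono_b] by simp
  ultimately show ?thesis using j by (intro exI[of _ n]) (simp add: n_def)
qed

text \<open>For \<open>n\<close> as in \<open>sparse\<close>, the \<open>2 ^ c n\<close> intervals
  of length \<open>(1/2) ^ n\<close> covering a piece have total length at most
  \<open>(1/2) ^ g\<close>.\<close>

lemma lborel_spt: "emeasure lborel (spt \<nu>) = 0"
proof -
  have "emeasure lborel (piece k) = 0" for k
  proof -
    have "emeasure lborel (piece k) \<le> 0 + ennreal e" if "0 < e" for e :: real
    proof -
      obtain g :: nat where g: "(1/2) ^ g < e" using real_arch_pow_inv[of e "1/2"] \<open>0 < e\<close> by auto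
      obtain n where n: "c n + g \<le> n" using sparse by blast
      have "emeasure lborel (piece k) \<le> emeasure lborel (\<Union>F\<in>Pow {..<c n}. {pos F + 2 * real k .. pos F + 2 * real k + (1/2) ^ n})"
        by (intro emeasure_mono piece_cover) auto
      also have "\<dots> \<le> (\<Sum>F\<in>Pow {..<c n}. emeasure lborel {pos F + 2 * real k .. pos F + 2 * real k + (1/2) ^ n})"
        by (intro emeasure_subadditive_finite) auto
      also have "\<dots> = (\<Sum>F\<in>Pow {..<c n}. ennreal ((1/2) ^ n))" by (intro sum.cong) auto
      also have "\<dots> = ennreal (\<Sum>F\<in>Pow {..<c n}. (1/2) ^ n)" by (intro sum_ennreal) simp
      also have "(\<Sum>F\<in>Pow {..<c n}. (1/2 :: real) ^ n) = 2 ^ c n * (1/2) ^ n" by (simp add: card_Pow)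
      also have "ennreal (2 ^ c n * (1/2) ^ n) \<le> ennreal (2 ^ c n * (1/2) ^ (c n + g))"
        using n by (intro ennreal_leI mult_left_mono power_decreasing) auto
      also have "2 ^ c n * (1/2 :: real) ^ (c n + g) = (1/2) ^ g" by (simp add: power_add power_divide)
      also have "ennreal ((1/2) ^ g) \<le> ennreal e" using g by (intro ennreal_leI) simp
      finally show ?thesis by simp
    qed
    then show ?thesis by (metis ennreal_le_epsilon le_zero_eq)
  qed
  then have "emeasure lborel (\<Union>k. piece k) = 0" by (intro emeasure_UN_eq_0) (auto simp: piece_def)
  moreover have "(\<Union>k. piece k) \<in> sets lborel" by (auto simp: piece_def)
  ultimately show ?thesis using emeasure_mono[OF spt_subset_pieces, of lborel] by simp
qed

lemma mutually_singular_\<nu>: "mutually_singular \<nu> lborel"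
  unfolding mutually_singular_def
proof (intro conjI bexI[of _ "- spt \<nu>"])
  show "emeasure \<nu> (- spt \<nu>) = 0" by (rule emeasure_Compl_spt) simp
  show "emeasure lborel (space lborel - - spt \<nu>) = 0" using lborel_spt by (simp add: Diff_eq)
  show "- spt \<nu> \<in> sets \<nu>" using borel_closed[OF closed_spt[of \<nu>]] by simp
qed simp

text \<open>A cover may use a scale of its choice, so it suffices that scales with few cells occur
  infinitely often.\<close>

lemma hausdorff_dim_spt_le:
  fixes \<alpha> :: real
  assumes "0 \<le> \<alpha>" and often: "\<And>(t :: real) m. \<alpha> < t \<Longrightarrow> \<exists>n\<ge>m. real (c n) \<le> t * n"
  shows "hausdorff_dim (spt \<nu>) \<le> ereal \<alpha>"
proof (rule hausdorff_dim_le[OF assms(1)])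
  fix s assume "\<alpha> < s"
  \<comment> \<open>The room between \<open>t\<close> and \<open>s\<close> makes the cost
    \<open>2 powr (c n - s * n)\<close> decay along the good scales.\<close>
  define t where "t = (\<alpha> + s) / 2"
  have t: "\<alpha> < t" "t < s" using \<open>\<alpha> < s\<close> by (auto simp: t_def)
  have "0 < s" using \<open>\<alpha> < s\<close> assms(1) by simp
  have pre: "hausdorff_pre s \<delta> (piece k) = 0" if "0 < \<delta>" for \<delta> k
  proof -
    have "hausdorff_pre s \<delta> (piece k) \<le> 0 + ennreal e" if "0 < e" for e :: real
    proof -
      have "(\<lambda>n. (1/2 :: real) ^ n) \<longlonglongrightarrow> 0" by (intro LIMSEQ_power_zero) simp
      then have "\<forall>\<^sub>F n in sequentially. (1/2 :: real) ^ n < \<delta>" using \<open>0 < \<delta>\<close> by (rule order_tendstoD)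
      moreover have "\<forall>\<^sub>F n in sequentially. 2 powr (- ((s - t) * real n)) < e"
      proof (rule order_tendstoD(2)[OF _ \<open>0 < e\<close>])
        show "(\<lambda>n. 2 powr (- ((s - t) * real n))) \<longlonglongrightarrow> 0"
        proof -
          have "2 powr (- (s - t)) < 2 powr (0 :: real)" using t(2) by (intro powr_less_mono) auto
          then have "(\<lambda>n. (2 powr (- (s - t))) ^ n) \<longlonglongrightarrow> 0" by (intro LIMSEQ_power_zero) simp
          then show ?thesis by (simp add: powr_power algebra_simps)
        qed
      qed
      ultimately have "\<forall>\<^sub>F n in sequentially. (1/2 :: real) ^ n < \<delta> \<and> 2 powr (- ((s - t) * real n)) < e"
        by (rule eventually_conj)
      then obtain m where m: "\<And>n. n \<ge> m \<Longrightarrow> (1/2 :: real) ^ n < \<delta> \<and> 2 powr (- ((s - t) * real n)) < e"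
        by (auto simp: eventually_sequentially)
      obtain n where n: "n \<ge> m" "real (c n) \<le> t * n" using often[OF t(1)] by blast
      let ?U = "\<lambda>F. {pos F + 2 * real k .. pos F + 2 * real k + (1/2) ^ n}"
      have "hausdorff_pre s \<delta> (piece k) \<le> (\<Sum>F\<in>Pow {..<c n}. diam_pow s (?U F))"
        using m[OF n(1)] \<open>0 < \<delta>\<close>
        by (intro hausdorff_pre_le_finite_cover piece_cover) (auto simp: diameter_closed_interval)
      also have "\<dots> = (\<Sum>F\<in>Pow {..<c n}. ennreal (((1/2) ^ n) powr s))"
        using \<open>0 < s\<close> by (intro sum.cong) (auto simp: diam_pow_def diameter_closed_interval)
      also have "\<dots> = ennreal (\<Sum>F\<in>Pow {..<c n}. ((1/2) ^ n) powr s)" by (intro sum_ennreal) simp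
      also have "(\<Sum>F\<in>Pow {..<c n}. ((1/2 :: real) ^ n) powr s) = 2 powr (real (c n) - s * n)"
        by (simp add: card_Pow half_powr_nat powr_diff powr_minus_divide powr_realpow)
      also have "ennreal (2 powr (real (c n) - s * n)) \<le> ennreal (2 powr (- ((s - t) * real n)))"
        using n(2) by (intro ennreal_leI powr_mono) (auto simp: algebra_simps)
      also have "\<dots> \<le> ennreal e" using m[OF n(1)] by (intro ennreal_leI) simp
      finally show ?thesis by simp
    qed
    then show ?thesis by (metis ennreal_le_epsilon le_zero_eq)
  qed
  have "hausdorff_pre s \<delta> (spt \<nu>) = 0" if "0 < \<delta>" for \<delta>
    using hausdorff_pre_mono[OF spt_subset_pieces, of s \<delta>] hausdorff_pre_Union_eq_0[OF pre[OF that]] by simp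
  then show "hausdorff_measure s (spt \<nu>) = 0"
    unfolding hausdorff_measure_def by (intro antisym SUP_least) auto
qed

text \<open>Packings may use every radius, so few cells are required at all late scales. Mass is
  measured by the law of \<open>point w + 2 * real k\<close>, under which, unlike under
  \<open>\<nu>\<close>, every cylinder is carried into \<open>piece k\<close>.\<close>

lemma packing_dim_spt_le:
  fixes \<beta> :: real
  assumes "0 \<le> \<beta>" and ev: "\<And>t :: real. \<beta> < t \<Longrightarrow> \<exists>m. \<forall>n\<ge>m. real (c n) \<le> t * n"
  shows "packing_dim (spt \<nu>) \<le> ereal \<beta>"
proof (rule packing_dim_le[OF assms(1)])
  fix s assume "\<beta> < s"
  define t where "t = (\<beta> + s) / 2"
  have t: "\<beta> < t" "t < s" "0 < t" using \<open>\<beta> < s\<close> assms(1) by (auto simp: t_def)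
  obtain m where m: "\<And>n. n \<ge> m \<Longrightarrow> real (c n) \<le> t * n" using ev[OF t(1)] by blast
  have "packing_premeasure s (piece k) = 0" for k
  proof (rule packing_premeasure_eq_0[of "distr coin borel (\<lambda>w. point w + 2 * real k)" t s "2 powr (- (2 * t))" "(1/2) ^ m"])
    show "finite_measure (distr coin borel (\<lambda>w. point w + 2 * real k))"
      by (intro coin.finite_measure_distr) simp
    fix x r :: real assume x: "x \<in> piece k" and r: "0 < r" "r \<le> (1/2) ^ m"
    obtain n where n: "m \<le> n" "(1/2) ^ Suc n < r" "r \<le> (1/2) ^ n" using r by (rule dyadic_scale)
    \<comment> \<open>Two levels below \<open>n\<close>, the distance of \<open>x\<close> to the
      image of \<open>w0\<close> and the length of a cell are at most \<open>(1/2) ^ (n + 2)\<close>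
      each, together \<open>(1/2) ^ Suc n < r\<close>. These two levels cost the factor
      \<open>2 powr (- (2 * t))\<close>.\<close>
    have "\<exists>y\<in>range (\<lambda>w. point w + 2 * real k). dist y x < (1/2) ^ (n + 2)"
      using x unfolding piece_def closure_approachable by (elim allE[of _ "(1/2) ^ (n + 2)"]) simp
    then obtain w0 where w0: "dist (point w0 + 2 * real k) x < (1/2) ^ (n + 2)" by blast
    define P where "P = {j. j < c (n + 2) \<and> w0 j}"
    have "{w. \<forall>j<c (n + 2). w j = (j \<in> P)} \<subseteq> {w. point w + 2 * real k \<in> cball x r}"
    proof (intro subsetI CollectI)
      fix w assume w: "w \<in> {w. \<forall>j<c (n + 2). w j = (j \<in> P)}"
      have P: "{j. j < c (n + 2) \<and> w j} = P"
      proof (rule set_eqI)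
        fix j show "j \<in> {j. j < c (n + 2) \<and> w j} \<longleftrightarrow> j \<in> P"
          using w by (cases "j < c (n + 2)") (simp_all add: P_def)
      qed
      have "\<bar>point w - point w0\<bar> \<le> (1/2) ^ (n + 2)"
        using cell(1)[of "n + 2" w] cell(2)[of w "n + 2"] cell(1)[of "n + 2" w0] cell(2)[of w0 "n + 2"] unfolding P P_def[symmetric] by linarith
      then have "dist (point w + 2 * real k) x \<le> (1/2) ^ (n + 2) + (1/2) ^ (n + 2)"
        using w0 unfolding dist_real_def by linarith
      also have "\<dots> = (1/2) ^ Suc n" by (simp add: power_add)
      finally show "point w + 2 * real k \<in> cball x r" using n(2) by (simp add: dist_commute)
    qed
    then have "emeasure coin {w. \<forall>j<c (n + 2). w j = (j \<in> P)} \<le> emeasure coin {w. point w + 2 * real k \<in> cball x r}"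
      by (rule emeasure_mono) (rule sets_coin_vimage[where M = borel], simp_all)
    then have "(1/2) ^ c (n + 2) \<le> measure coin {w. point w + 2 * real k \<in> cball x r}"
      unfolding emeasure_coin_cylinder by (simp add: coin.emeasure_eq_measure)
    also have "\<dots> = measure (distr coin borel (\<lambda>w. point w + 2 * real k)) (cball x r)"
      by (subst measure_distr) (auto simp: vimage_def)
    finally have mass: "(1/2) ^ c (n + 2) \<le> measure (distr coin borel (\<lambda>w. point w + 2 * real k)) (cball x r)" .
    have "2 powr (- (2 * t)) * r powr t \<le> 2 powr (- (2 * t)) * ((1/2) ^ n) powr t"
      using n(3) r(1) t(3) by (intro mult_left_mono powr_mono2) auto
    also have "\<dots> = 2 powr (- (t * real (n + 2)))"
      by (simp add: half_powr_nat algebra_simps flip: powr_add)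
    also have "\<dots> \<le> 2 powr (- real (c (n + 2)))"
      using m[of "n + 2"] n(1) by (intro powr_mono) auto
    also have "\<dots> = (1/2) ^ c (n + 2)" by (simp only: half_power_eq_powr)
    also note mass
    finally show "2 powr (- (2 * t)) * r powr t \<le> measure (distr coin borel (\<lambda>w. point w + 2 * real k)) (cball x r)" .
  qed (use t in auto)
  then have "packing_measure s (spt \<nu>) \<le> (\<Sum>k. 0)"
    unfolding packing_measure_def using spt_subset_pieces by (intro INF_lower2[of piece]) auto
  then show "packing_measure s (spt \<nu>) = 0" by simp
qed

text \<open>Covering sets may have any small size, so many cells are required at all late
  scales.\<close>

lemma hausdorff_dim_spt_ge:
  fixes \<alpha> :: real
  assumes ev: "\<And>t :: real. t < \<alpha> \<Longrightarrow> \<exists>m. \<forall>n\<ge>m. t * n \<le> real (c n)"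
  shows "ereal \<alpha> \<le> hausdorff_dim (spt \<nu>)"
proof (rule hausdorff_dim_ge)
  fix s assume s: "0 \<le> s" "s < \<alpha>"
  obtain m where m: "\<And>n. n \<ge> m \<Longrightarrow> s * n \<le> real (c n)" using ev[OF s(2)] by blast
  show "hausdorff_measure s (spt \<nu>) \<noteq> 0"
  \<comment> \<open>From \<open>(1/2) ^ Suc n < 2 * r\<close> follows
    \<open>(1/2) ^ n < 4 * r\<close>, hence \<open>4 powr s\<close>; the 3 stems from
    \<open>emeasure_cell_le\<close>. The bound on the radius ensures \<open>Suc m \<le> n\<close>,
    and with it \<open>1 \<le> n\<close>.\<close>
  proof (rule mass_distribution_principle[of \<nu> "spt \<nu>" s "3 * 4 powr s" "(1/2) ^ Suc (Suc m)"])
    fix x r :: real assume r: "0 < r" "r \<le> (1/2) ^ Suc (Suc m)"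
    then have "0 < 2 * r" "2 * r \<le> (1/2) ^ Suc m" by auto
    then obtain n where n: "Suc m \<le> n" "(1/2) ^ Suc n < 2 * r" "2 * r \<le> (1/2) ^ n" by (rule dyadic_scale)
    have "(1/2 :: real) ^ c n = 2 powr (- real (c n))" by (rule half_power_eq_powr)
    also have "\<dots> \<le> 2 powr (- (s * n))" using m[of n] n(1) by (intro powr_mono) auto
    also have "\<dots> = ((1/2) ^ n) powr s" by (simp only: half_powr_nat)
    also have "\<dots> \<le> (4 * r) powr s" using n(2) s(1) by (intro powr_mono2) auto
    also have "\<dots> = 4 powr s * r powr s" using r(1) by (simp add: powr_mult)
    finally have "ennreal (3 * (1/2) ^ c n) \<le> ennreal (3 * 4 powr s * r powr s)" by (intro ennreal_leI) simp
    with emeasure_\<nu>_cball_le[OF n(3), of x] n(1)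
    show "emeasure \<nu> (cball x r) \<le> ennreal (3 * 4 powr s * r powr s)" by (auto intro: order_trans)
  qed (use s emeasure_\<nu>_spt in auto)
qed

text \<open>A packing may use one radius of its choice, so scales with many cells need to occur only
  infinitely often.\<close>

lemma packing_dim_spt_ge:
  fixes \<beta> :: real
  assumes often: "\<And>(t :: real) m. t < \<beta> \<Longrightarrow> \<exists>n\<ge>m. t * n \<le> real (c n)"
  shows "ereal \<beta> \<le> packing_dim (spt \<nu>)"
proof (rule packing_dim_ge)
  fix s assume s: "0 \<le> s" "s < \<beta>"
  show "packing_measure s (spt \<nu>) \<noteq> 0"
  proof (rule packing_measure_nonzero[of \<nu> "spt \<nu>" "3 * 10 powr s"])
    fix \<delta> :: real assume "0 < \<delta>"
    then obtain m where m: "(1/2) ^ m < \<delta>" using real_arch_pow_inv[of \<delta> "1/2"] by auto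
    obtain n where n: "n \<ge> Suc m" "s * n \<le> real (c n)" using often[OF s(2)] by blast
    \<comment> \<open>Then \<open>2 * (5 * r) = (1/2) ^ n\<close>, as
      \<open>emeasure_\<nu>_cball_le\<close> asks of a ball of radius \<open>5 * r\<close>.\<close>
    define r :: real where "r = (1/2) ^ n / 10"
    have "(1/2 :: real) ^ n \<le> (1/2) ^ m" using n(1) by (intro power_decreasing) auto
    moreover have "0 < r" "r \<le> (1/2) ^ n" by (simp_all add: r_def)
    ultimately have r: "0 < r" "r \<le> \<delta>" using m by linarith+
    have "(1/2 :: real) ^ c n = 2 powr (- real (c n))" by (rule half_power_eq_powr)
    also have "\<dots> \<le> 2 powr (- (s * n))" using n(2) by (intro powr_mono) auto
    also have "\<dots> = (10 * r) powr s" by (simp only: half_powr_nat r_def) (simp add: half_powr_nat)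
    also have "\<dots> = 10 powr s * r powr s" using r(1) by (simp add: powr_mult)
    finally have "ennreal (3 * (1/2) ^ c n) \<le> ennreal (3 * 10 powr s * r powr s)" by (intro ennreal_leI) simp
    moreover have "emeasure \<nu> (cball x (5 * r)) \<le> ennreal (3 * (1/2) ^ c n)" for x
      using n(1) by (intro emeasure_\<nu>_cball_le) (auto simp: r_def)
    ultimately have "emeasure \<nu> (cball x (5 * r)) \<le> ennreal (3 * 10 powr s * r powr s)" for x
      by (rule order_trans[rotated])
    then show "\<exists>r. 0 < r \<and> r \<le> \<delta> \<and> (\<forall>x. emeasure \<nu> (cball x (5 * r)) \<le> ennreal (3 * 10 powr s * r powr s))"
      using r by blast
  qed (use emeasure_\<nu>_spt borel_closed[OF closed_spt[of \<nu>]] in auto)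
qed

end

section \<open>Digit positions with prescribed densities\<close>

definition spike :: "nat set" where
  "spike = range (\<lambda>k. k ^ 3)"

text \<open>Behind cubes, blocks of length \<open>k\<close> have density zero; behind squares they
  would fill half of the numbers.\<close>

definition hole :: "nat set" where
  "hole = {n. \<exists>k. k ^ 3 < n \<and> n \<le> k ^ 3 + k}"

text \<open>
  Digit positions are chosen greedily so that their relative frequency follows \<open>\<tau>\<close>. The set \<^const>\<open>spike\<close>
  forces infinitely many positions (needed if \<open>\<tau>\<close> vanishes) and \<^const>\<open>hole\<close> forces arbitrarily long
  gaps; both have density zero.
\<close>

primrec greedy :: "(nat \<Rightarrow> real) \<Rightarrow> nat \<Rightarrow> nat" where
  "greedy \<tau> 0 = 0"
| "greedy \<tau> (Suc n) =
    (if n \<in> spike \<or> n \<notin> hole \<and> real (greedy \<tau> n) < \<tau> n * n then Suc (greedy \<tau> n) else greedy \<tau> n)"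

text \<open>Counts the steps at which the comparison with \<open>\<tau>\<close> may be overridden;
  this is the error term of the density estimates.\<close>

definition forced :: "nat \<Rightarrow> nat" where
  "forced n = card ((spike \<union> hole) \<inter> {..<n})"

section \<open>Deviation of the greedy count from its target\<close>

lemma forced_Suc: "forced (Suc n) = forced n + (if n \<in> spike \<union> hole then 1 else 0)"
  by (simp add: forced_def lessThan_Suc Int_insert_right)

lemma greedy_le: "greedy \<tau> n \<le> n"
  by (induction n) auto

lemma mono_greedy: "mono (greedy \<tau>)"
  by (rule mono_iff_le_Suc[THEN iffD2]) simp

text \<open>Apart from spikes, the count grows only while it is below \<open>\<theta> * n\<close>,
  so it overshoots by at most 1; \<open>T\<close> bounds what was accumulated before the block,
  \<open>forced n\<close> the spikes.\<close>

lemma greedy_upper: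
  fixes \<theta> :: real and T n T' :: nat
  assumes "T \<le> n" "n \<le> T'" "0 \<le> \<theta>" "\<And>i. T \<le> i \<Longrightarrow> i < T' \<Longrightarrow> \<tau> i \<le> \<theta>"
  shows "real (greedy \<tau> n) \<le> \<theta> * n + 1 + T + forced n"
  using assms(1,2)
proof (induction n rule: dec_induct)
  case base
  have "0 \<le> \<theta> * T" using \<open>0 \<le> \<theta>\<close> by simp
  moreover have "real (greedy \<tau> T) \<le> T" using greedy_le[of \<tau> T] by simp
  ultimately show ?case by linarith
next
  case (step n)
  have "\<tau> n * n \<le> \<theta> * n" using step assms(4) by (intro mult_right_mono) auto
  moreover have "\<theta> * n \<le> \<theta> * Suc n" using \<open>0 \<le> \<theta>\<close> by (intro mult_left_mono) auto
  ultimately show ?case using step by (auto simp: forced_Suc)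
qed

text \<open>Outside holes, a step without growth means that the count is already at least
  \<open>\<theta> * n\<close>, and a step with growth gains at least the slope, as
  \<open>\<theta> \<le> 1\<close>.\<close>

lemma greedy_lower:
  fixes \<theta> :: real and T n T' :: nat
  assumes "T \<le> n" "n \<le> T'" "\<theta> \<le> 1" "\<And>i. T \<le> i \<Longrightarrow> i < T' \<Longrightarrow> \<theta> \<le> \<tau> i"
  shows "\<theta> * n - 1 - T - forced n \<le> real (greedy \<tau> n)"
  using assms(1,2)
proof (induction n rule: dec_induct)
  case base
  have "\<theta> * T \<le> 1 * real T" using \<open>\<theta> \<le> 1\<close> by (intro mult_right_mono) auto
  then show ?case by simp
next
  case (step n)
  have "\<theta> * n \<le> \<tau> n * n" using step assms(4) by (intro mult_right_mono) auto
  moreover have "\<theta> * Suc n \<le> \<theta> * n + 1" using \<open>\<theta> \<le> 1\<close> by (simp add: distrib_left)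
  ultimately show ?case using step by (auto simp: forced_Suc)
qed

lemma not_spike: "k ^ 3 < n \<Longrightarrow> n \<le> k ^ 3 + k \<Longrightarrow> n \<notin> spike"
proof
  assume n: "k ^ 3 < n" "n \<le> k ^ 3 + k" "n \<in> spike"
  then obtain j where j: "n = j ^ 3" by (auto simp: spike_def)
  then have "k < j" using n(1) power_less_imp_less_base[of k 3 j] by simp
  then have "Suc k ^ 3 \<le> j ^ 3" by (intro power_mono) auto
  moreover have "k ^ 3 + k < Suc k ^ 3" by (simp add: power3_eq_cube algebra_simps)
  ultimately show False using n(2) unfolding j by linarith
qed

text \<open>The hole behind \<open>k ^ 3\<close> has length \<open>k = m + g\<close>, and no cube
  falls into it.\<close>

lemma greedy_gaps: "\<exists>n\<ge>m. greedy \<tau> (n + g) = greedy \<tau> n"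
proof -
  define k where "k = m + g"
  define n where "n = Suc (k ^ 3)"
  have "greedy \<tau> (n + i) = greedy \<tau> n" if "i \<le> g" for i
    using that
  proof (induction i)
    case (Suc i)
    have "k ^ 3 < n + i" "n + i \<le> k ^ 3 + k" using Suc.prems by (auto simp: n_def k_def)
    then have "n + i \<in> hole" "n + i \<notin> spike" using not_spike by (auto simp: hole_def)
    then show ?case using Suc by simp
  qed simp
  moreover have "m \<le> k ^ 3"
  proof -
    have "k \<le> k ^ 3" by (cases "k = 0") (simp_all add: self_le_power)
    then show ?thesis by (simp add: k_def)
  qed
  ultimately show ?thesis by (intro exI[of _ n]) (simp add: n_def)
qed

lemma greedy_unbounded: "k < greedy \<tau> (Suc (k ^ 3))"
proof (induction k)
  case 0
  have "0 \<in> spike" by (auto simp: spike_def intro: rev_image_eqI[of 0])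
  then show ?case by simp
next
  case (Suc k)
  have "k ^ 3 < Suc k ^ 3" by (intro power_strict_mono) auto
  then have "greedy \<tau> (Suc (k ^ 3)) \<le> greedy \<tau> (Suc k ^ 3)" by (intro monoD[OF mono_greedy]) simp
  moreover have "Suc k ^ 3 \<in> spike" by (auto simp: spike_def)
  ultimately show ?case using Suc by (simp del: power_Suc)
qed

text \<open>Every forced step has the form \<open>k ^ 3 + i\<close> with
  \<open>i \<le> k < r\<close>.\<close>

lemma forced_le_square:
  assumes "n \<le> r ^ 3"
  shows "forced n \<le> r\<^sup>2"
proof -
  have "(spike \<union> hole) \<inter> {..<n} \<subseteq> (\<lambda>(k, i). k ^ 3 + i) ` ({..<r} \<times> {..<r})"
  proof
    fix x assume x: "x \<in> (spike \<union> hole) \<inter> {..<n}"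
    then consider k where "x = k ^ 3" | k where "k ^ 3 < x" "x \<le> k ^ 3 + k"
      by (auto simp: spike_def hole_def)
    then obtain k where k: "k ^ 3 \<le> x" "x \<le> k ^ 3 + k"
    proof cases
      case (1 k)
      then show ?thesis by (intro that[of k]) auto
    next
      case (2 k)
      then show ?thesis by (intro that[of k]) auto
    qed
    define i where "i = x - k ^ 3"
    have ki: "x = k ^ 3 + i" "i \<le> k" using k by (auto simp: i_def)
    have "k ^ 3 < r ^ 3" using x ki assms by simp
    then have "k < r" using power_less_imp_less_base[of k 3 r] by simp
    with ki show "x \<in> (\<lambda>(k, i). k ^ 3 + i) ` ({..<r} \<times> {..<r})" by (intro image_eqI[of _ _ "(k, i)"]) auto
  qed
  then have "forced n \<le> card ((\<lambda>(k, i). k ^ 3 + i) ` ({..<r} \<times> {..<r}))"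
    unfolding forced_def by (intro card_mono) auto
  also have "\<dots> \<le> card ({..<r} \<times> {..<r})" by (intro card_image_le) auto
  also have "\<dots> = r\<^sup>2" by (simp add: power2_eq_square)
  finally show ?thesis .
qed

text \<open>With \<open>r\<close> the cube root of \<open>n\<close> rounded up,
  \<open>forced n\<close> is at most of order \<open>n powr (2/3)\<close>.\<close>

lemma forced_small:
  fixes \<epsilon> :: real
  assumes "0 < \<epsilon>"
  shows "\<forall>\<^sub>F n in sequentially. 1 + real (forced n) \<le> \<epsilon> * n"
proof -
  have "(\<lambda>n::nat. (1 + (real n powr (1/3) + 1)\<^sup>2) / real n) \<longlonglongrightarrow> 0" by real_asymp
  then have "\<forall>\<^sub>F n::nat in sequentially. (1 + (real n powr (1/3) + 1)\<^sup>2) / real n < \<epsilon>"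
    using assms by (rule order_tendstoD)
  then show ?thesis using eventually_gt_at_top[of 0]
  proof eventually_elim
    case (elim n)
    define r where "r = nat \<lceil>real n powr (1/3)\<rceil>"
    have r: "real n powr (1/3) \<le> real r" "real r \<le> real n powr (1/3) + 1"
      unfolding r_def using powr_ge_zero[of "real n" "1/3"] by linarith+
    have "real n = (real n powr (1/3)) ^ 3" using elim(2) by (simp add: powr_power)
    also have "\<dots> \<le> real r ^ 3" using r(1) by (intro power_mono) auto
    finally have "n \<le> r ^ 3" by (simp flip: of_nat_power)
    then have "real (forced n) \<le> real (r\<^sup>2)" using forced_le_square by simp
    also have "\<dots> \<le> (real n powr (1/3) + 1)\<^sup>2" using r(2) by (simp add: power_mono)
    finally show ?case using elim by (simp add: pos_divide_less_eq)
  qed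
qed

text \<open>The density oscillates between \<open>\<alpha>\<close> and \<open>\<beta>\<close> since each factorial block dwarfs all previous ones.\<close>

definition target :: "real \<Rightarrow> real \<Rightarrow> nat \<Rightarrow> real" where
  "target \<alpha> \<beta> n = (if \<exists>i. fact (2 * i) \<le> n \<and> n < fact (2 * i + 1) then \<alpha> else \<beta>)"

lemma target_odd_block:
  assumes "fact (2 * i + 1) \<le> n" "n < fact (2 * i + 2)"
  shows "target \<alpha> \<beta> n = \<beta>"
proof -
  have False if j: "fact (2 * j) \<le> n" "n < fact (2 * j + 1)" for j
  proof (cases "j \<le> i")
    case True
    then have "fact (2 * j + 1) \<le> (fact (2 * i + 1) :: nat)" by (intro fact_mono) auto
    with j assms show False by simp
  next
    case False
    then have "fact (2 * i + 2) \<le> (fact (2 * j) :: nat)" by (intro fact_mono) auto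
    with j assms show False by simp
  qed
  then show ?thesis by (auto simp: target_def)
qed

lemma le_fact: "n \<le> (fact n :: nat)"
  by (rule fact_ge_self)

text \<open>What was counted before a block is at most its left end \<open>fact j\<close>, a
  fraction \<open>1 / Suc j\<close> of its right end.\<close>

lemma block_error_small:
  fixes \<epsilon> :: real
  assumes "0 < \<epsilon>"
  shows "\<forall>\<^sub>F j in sequentially. 1 + real (fact j) + real (forced (fact (Suc j))) \<le> \<epsilon> * real (fact (Suc j))"
proof -
  have lim: "filterlim (\<lambda>j. fact (Suc j) :: nat) sequentially sequentially"
    by (rule filterlim_at_top_mono[OF filterlim_ident]) (auto intro!: always_eventually order_trans[OF _ le_fact] simp del: fact_Suc)
  have "\<forall>\<^sub>F j in sequentially. 1 + real (forced (fact (Suc j))) \<le> \<epsilon> / 2 * real (fact (Suc j))"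
    using lim forced_small[of "\<epsilon> / 2"] assms by (auto dest: eventually_compose_filterlim)
  moreover have "\<forall>\<^sub>F j::nat in sequentially. 2 / \<epsilon> \<le> real j"
    using filterlim_real_sequentially by (simp add: filterlim_at_top)
  ultimately show ?thesis
  proof eventually_elim
    case (elim j)
    have "real (fact j) * 1 \<le> real (fact j) * (\<epsilon> / 2 * real (Suc j))"
      using elim(2) assms by (intro mult_left_mono) (auto simp: field_simps)
    also have "\<dots> = \<epsilon> / 2 * real (fact (Suc j))" by (simp add: algebra_simps)
    finally show ?case using elim(1) by (simp add: field_simps)
  qed
qed

text \<open>The bounds for all large \<open>n\<close> use \<open>T = 0\<close>, as the target always
  lies between \<open>\<alpha>\<close> and \<open>\<beta>\<close>. The bounds for infinitely many
  \<open>n\<close> evaluate the count at the right end of a block.\<close>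

lemma greedy_density:
  fixes \<alpha> \<beta> t :: real and c :: "nat \<Rightarrow> nat"
  assumes "0 \<le> \<alpha>" "\<alpha> \<le> \<beta>" "\<beta> \<le> 1"
  defines "c \<equiv> greedy (target \<alpha> \<beta>)"
  shows "\<alpha> < t \<Longrightarrow> \<exists>n\<ge>m. real (c n) \<le> t * n"
    and "\<beta> < t \<Longrightarrow> \<exists>m. \<forall>n\<ge>m. real (c n) \<le> t * n"
    and "t < \<alpha> \<Longrightarrow> \<exists>m. \<forall>n\<ge>m. t * n \<le> real (c n)"
    and "t < \<beta> \<Longrightarrow> \<exists>n\<ge>m. t * n \<le> real (c n)"
proof -
  have target: "\<alpha> \<le> target \<alpha> \<beta> i" "target \<alpha> \<beta> i \<le> \<beta>" for i
    using assms by (auto simp: target_def)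
  show "\<exists>m. \<forall>n\<ge>m. real (c n) \<le> t * n" if "\<beta> < t"
  proof -
    have "\<forall>\<^sub>F n in sequentially. 1 + real (forced n) \<le> (t - \<beta>) * n"
      using that by (intro forced_small) simp
    then have "\<forall>\<^sub>F n in sequentially. real (c n) \<le> t * n"
    proof eventually_elim
      case (elim n)
      then show ?case using greedy_upper[of 0 n n \<beta> "target \<alpha> \<beta>"] assms target
        by (simp add: c_def left_diff_distrib)
    qed
    then show ?thesis by (simp add: eventually_sequentially)
  qed
  show "\<exists>m. \<forall>n\<ge>m. t * n \<le> real (c n)" if "t < \<alpha>"
  proof -
    have "\<forall>\<^sub>F n in sequentially. 1 + real (forced n) \<le> (\<alpha> - t) * n"
      using that by (intro forced_small) simp
    then have "\<forall>\<^sub>F n in sequentially. t * n \<le> real (c n)"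
    proof eventually_elim
      case (elim n)
      then show ?case using greedy_lower[of 0 n n \<alpha> "target \<alpha> \<beta>"] assms target
        by (simp add: c_def left_diff_distrib)
    qed
    then show ?thesis by (simp add: eventually_sequentially)
  qed
  show "\<exists>n\<ge>m. real (c n) \<le> t * n" if lt: "\<alpha> < t"
  proof -
    obtain J where J: "\<And>j. j \<ge> J \<Longrightarrow> 1 + real (fact j) + real (forced (fact (Suc j))) \<le> (t - \<alpha>) * real (fact (Suc j))"
      using block_error_small[of "t - \<alpha>"] lt unfolding eventually_sequentially by (metis diff_gt_0_iff_gt)
    define i where "i = max J m"
    \<comment> \<open>The right end of a block with target \<open>\<alpha>\<close>; its left end
      \<open>fact (2 * i)\<close> serves as \<open>T\<close>.\<close>
    define n :: nat where "n = fact (2 * i + 1)"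
    have "real (c n) \<le> \<alpha> * n + 1 + real (fact (2 * i)) + forced n"
      unfolding c_def by (rule greedy_upper[where T' = n]) (auto simp: n_def target_def assms intro!: fact_mono)
    moreover have "1 + real (fact (2 * i)) + real (forced n) \<le> (t - \<alpha>) * n"
      using J[of "2 * i"] by (simp add: n_def i_def)
    moreover have "m \<le> n" using le_fact[of "2 * i + 1"] unfolding n_def i_def by linarith
    ultimately show ?thesis by (intro exI[of _ n]) (simp add: left_diff_distrib)
  qed
  show "\<exists>n\<ge>m. t * n \<le> real (c n)" if lt: "t < \<beta>"
  proof -
    obtain J where J: "\<And>j. j \<ge> J \<Longrightarrow> 1 + real (fact j) + real (forced (fact (Suc j))) \<le> (\<beta> - t) * real (fact (Suc j))"
      using block_error_small[of "\<beta> - t"] lt unfolding eventually_sequentially by (metis diff_gt_0_iff_gt)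
    define i where "i = max J m"
    \<comment> \<open>The right end of a block with target \<open>\<beta>\<close>; its left end
      \<open>fact (2 * i + 1)\<close> serves as \<open>T\<close>.\<close>
    define n :: nat where "n = fact (2 * i + 2)"
    have "\<beta> * n - 1 - real (fact (2 * i + 1)) - forced n \<le> real (c n)"
      unfolding c_def
      by (rule greedy_lower[where T' = n]) (simp_all add: n_def target_odd_block[of i] assms fact_mono del: fact_Suc)
    moreover have "1 + real (fact (2 * i + 1)) + real (forced n) \<le> (\<beta> - t) * n"
      using J[of "2 * i + 1"] by (simp add: n_def i_def)
    moreover have "m \<le> n" using le_fact[of "2 * i + 2"] unfolding n_def i_def by linarith
    ultimately show ?thesis by (intro exI[of _ n]) (simp add: left_diff_distrib)
  qed
qed

text \<open>Position \<open>k\<close> is where the count first exceeds \<open>k\<close>. Growth from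
  \<open>greedy \<tau> i\<close> to \<open>greedy \<tau> (Suc i)\<close> thus marks position
  \<open>i + 1\<close>, whence \<open>0 < b 0\<close>.\<close>

lemma cantor_expansion_greedy:
  "cantor_expansion (\<lambda>k. LEAST n. k < greedy \<tau> n) (greedy \<tau>)"
proof -
  let ?c = "greedy \<tau>"
  define b where "b k = (LEAST n. k < ?c n)" for k
  have hit: "k < ?c (b k)" for k
    unfolding b_def by (rule LeastI) (rule greedy_unbounded)
  have count: "b k \<le> n \<longleftrightarrow> k < ?c n" for k n
  proof
    assume "b k \<le> n"
    then show "k < ?c n" using hit[of k] monoD[OF mono_greedy, of "b k" n \<tau>] by linarith
  qed (simp add: b_def Least_le)
  \<comment> \<open>The count starts at 0 and never jumps by more than 1, so distinct indices get
    distinct positions.\<close>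
  have exact: "?c (b k) = Suc k" for k
  proof (cases "b k")
    case 0
    then show ?thesis using hit[of k] by simp
  next
    case (Suc n)
    then have "\<not> k < ?c n" using count[of k n] by simp
    moreover have "?c (Suc n) \<le> Suc (?c n)" by simp
    ultimately show ?thesis using hit[of k] Suc by (simp del: greedy.simps)
  qed
  have "strict_mono b"
    unfolding strict_mono_Suc_iff
  proof
    fix k
    have "\<not> b (Suc k) \<le> b k" using count[of "Suc k" "b k"] exact[of k] by simp
    then show "b k < b (Suc k)" by simp
  qed
  moreover have "0 < b 0" using count[of 0 0] by simp
  moreover have "\<exists>n\<ge>m. b n + g \<le> b (Suc n)" for m g
  proof -
    \<comment> \<open>A stretch of length \<open>g\<close> without growth is a gap; starting it
      behind \<open>m ^ 3\<close> ensures that more than \<open>m\<close> positions precede its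
      end.\<close>
    obtain p where p: "p \<ge> Suc (m ^ 3)" "?c (p + g) = ?c p" using greedy_gaps by blast
    have "m < ?c p" using greedy_unbounded[of m \<tau>] monoD[OF mono_greedy p(1), of \<tau>] by linarith
    then obtain j where j: "?c p = Suc j" "m \<le> j" by (metis less_Suc_eq_le not0_implies_Suc not_less0)
    have "b j \<le> p" "\<not> b (Suc j) \<le> p + g" using count p(2) j(1) by auto
    then show ?thesis using j(2) by (intro exI[of _ j]) simp
  qed
  ultimately show ?thesis
    using count unfolding b_def by unfold_locales
qed

theorem theorem1p7:
  fixes \<alpha> \<beta> :: real
  assumes "0 \<le> \<alpha>" and "\<alpha> \<le> \<beta>" and "\<beta> \<le> 1"
  shows "\<exists>\<mu> :: real measure.
           spectral_measure \<mu> \<and> mutually_singular \<mu> lborel \<and> \<not> compact (spt \<mu>) \<and>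
           hausdorff_dim (spt \<mu>) = ereal \<alpha> \<and> packing_dim (spt \<mu>) = ereal \<beta>"
proof -
  let ?c = "greedy (target \<alpha> \<beta>)"
  interpret cantor_expansion "\<lambda>k. LEAST n. k < ?c n" ?c
    by (rule cantor_expansion_greedy)
  note density = greedy_density[OF assms]
  have "hausdorff_dim (spt \<nu>) = ereal \<alpha>"
    using assms density(1,3) by (intro antisym hausdorff_dim_spt_le hausdorff_dim_spt_ge) auto
  moreover have "packing_dim (spt \<nu>) = ereal \<beta>"
    using assms density(2,4) by (intro antisym packing_dim_spt_le packing_dim_spt_ge) auto
  ultimately show ?thesis
    using spectral_measure_\<nu> mutually_singular_\<nu> not_compact_spt by blast
qed

end
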